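(* Let $\lambda>0$ and let $\{X_n:n\geq 1\}$ be i.i.d. random variables with exponential distribution of rate $\lambda$, i.e. with common distribution function $F(t)=1-e^{-\lambda t}$ for $t\geq 0$. Let $w:[0,1]\to\mathbb{R}$ be a continuous function for which there exist $x_0\in(0,1)$ and $c>0$ such that $|w(x)|\leq c(1-x)$ for all $x\in[1-x_0,1]$, and set $h_w(x):=\frac{w(x)}{1-x}$ for $x\in[0,1)$. Assume that the function $\Lambda_w:\mathbb{R}\to\mathbb{R}\cup\{\infty\}$ defined by $$\Lambda_w(\theta):=\begin{cases}\displaystyle\int_0^1\log\left(\frac{\lambda}{\lambda-\theta h_w(x)}\right)dx & \text{if } \sup_{x\in[0,1)}\{\theta h_w(x)\}\leq\lambda,\\ \infty & \text{otherwise}\end{cases}$$ is finite in a neighbourhood of $\theta=0$. For $n\geq 1$ let $$C_n(w):=\sum_{k=0}^{n-1}w(k/n)\,(X_{k+1:n}-X_{k:n}),$$ where $X_{1:n}\leq\cdots\leq X_{n:n}$ are the ascending order statistics of $X_1,\ldots,X_n$ and $X_{0:n}:=0$. Then, for any sequence of positive numbers $\{a_n:n\geq 1\}$ such that $a_n\to 0$ and $na_n\to\infty$ as $n\to\infty$, the sequence $$\left\{\sqrt{na_n}\,\bigl(C_n(w)-\mathbb{E}[C_n(w)]\bigr):n\geq 1\right\}$$ satisfies the large deviation principle on $\mathbb{R}$ with speed function $v_n=1/a_n$ and good rate function $\tilde{\Lambda}_w^*$ defined by $$\tilde{\Lambda}_w^*(y):=\frac{y^2}{2\sigma_w^2},\qquad\text{where}\qquad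 \sigma_w^2:=\frac{1}{\lambda^2}\int_0^1\frac{w^2(x)}{(1-x)^2}dx.$$
   Context: Large deviation principle: a sequence of real random variables $\{Z_n:n\geq1\}$ satisfies the large deviation principle (LDP) with speed function $v_n$ and rate function $I$ if $\lim_{n\to\infty}v_n=\infty$; $I:\mathbb{R}\to[0,\infty]$ is lower semi-continuous; $\limsup_{n\to\infty}\frac{1}{v_n}\log P(Z_n\in C)\leq-\inf_{x\in C}I(x)$ for all closed sets $C\subseteq\mathbb{R}$; and $\liminf_{n\to\infty}\frac{1}{v_n}\log P(Z_n\in O)\geq-\inf_{x\in O}I(x)$ for all open sets $O\subseteq\mathbb{R}$. The rate function $I$ is good if its level sets $\{x\in\mathbb{R}:I(x)\leq\eta\}$, $\eta\geq 0$, are compact. In the definition of $\Lambda_w$ the integrand is taken to be $+\infty$ at points $x$ where $\theta h_w(x)=\lambda$. In the degenerate case $\sigma_w^2=0$ (i.e. $w\equiv0$), $\frac{y^2}{2\sigma_w^2}$ is read as $0$ for $y=0$ and $\infty$ for $y\neq 0$. *)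

theory Defs
  imports "HOL-Probability.Probability"
begin

section \<open>Large deviation principle\<close>

text \<open>Logarithm of a probability, with \<open>log 0 = -\<infinity>\<close> (whereas \<open>ln 0 = 0\<close> in the library).\<close>

definition ext_log :: "real \<Rightarrow> ereal" where
  "ext_log p = (if p = 0 then -\<infinity> else ereal (ln p))"

definition lower_semicont :: "(real \<Rightarrow> ereal) \<Rightarrow> bool" where
  "lower_semicont I \<longleftrightarrow> (\<forall>x. I x \<le> Liminf (at x) I)"

text \<open>
  Sequences are indexed from 1, so nothing is required of \<open>Z 0\<close> and \<open>v 0\<close>.
  The infimum over the empty set is \<open>\<infinity>\<close>.
\<close>

definition satisfies_LDP ::
  "'a measure \<Rightarrow> (nat \<Rightarrow> 'a \<Rightarrow> real) \<Rightarrow> (nat \<Rightarrow> real) \<Rightarrow> (real \<Rightarrow> ereal) \<Rightarrow> bool" where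
  "satisfies_LDP M Z v I \<longleftrightarrow>
     (\<forall>n\<ge>1. Z n \<in> borel_measurable M) \<and>
     filterlim v at_top sequentially \<and>
     (\<forall>x. 0 \<le> I x) \<and>
     lower_semicont I \<and>
     (\<forall>C. closed C \<longrightarrow>
        limsup (\<lambda>n. ereal (1 / v n) * ext_log (measure M {\<omega> \<in> space M. Z n \<omega> \<in> C}))
          \<le> - (INF x\<in>C. I x)) \<and>
     (\<forall>U. open U \<longrightarrow>
        - (INF x\<in>U. I x)
          \<le> liminf (\<lambda>n. ereal (1 / v n) * ext_log (measure M {\<omega> \<in> space M. Z n \<omega> \<in> U})))"

definition good_rate :: "(real \<Rightarrow> ereal) \<Rightarrow> bool" where
  "good_rate I \<longleftrightarrow> (\<forall>\<eta>::real. 0 \<le> \<eta> \<longrightarrow> compact {x. I x \<le> ereal \<eta>})"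

section \<open>Order statistics and the statistic $C_n(w)$\<close>

text \<open>\<open>order_stat X n k\<close> is $X_{k:n}$, formed from $X_1, \ldots, X_n$, with $X_{0:n} = 0$;
  it is meant for \<open>k \<le> n\<close>.\<close>

definition order_stat :: "(nat \<Rightarrow> 'a \<Rightarrow> real) \<Rightarrow> nat \<Rightarrow> nat \<Rightarrow> 'a \<Rightarrow> real" where
  "order_stat X n k \<omega> =
     (if k = 0 then 0 else sort (map (\<lambda>i. X i \<omega>) [1..<Suc n]) ! (k - 1))"

definition C_stat :: "(real \<Rightarrow> real) \<Rightarrow> (nat \<Rightarrow> 'a \<Rightarrow> real) \<Rightarrow> nat \<Rightarrow> 'a \<Rightarrow> real" where
  "C_stat w X n \<omega> =
     (\<Sum>k<n. w (real k / real n) * (order_stat X n (k + 1) \<omega> - order_stat X n k \<omega>))"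

section \<open>The functions $h_w$, $\Lambda_w$ and the rate function\<close>

definition h_fun :: "(real \<Rightarrow> real) \<Rightarrow> real \<Rightarrow> real" where
  "h_fun w x = w x / (1 - x)"

text \<open>
  Lebesgue integral of an extended real-valued function over \<open>A\<close>, as the integral of the
  positive part minus that of the negative part (\<open>e2ennreal\<close> sends negative values to \<open>0\<close>).
  It is meaningful when at most one of the two is infinite.
\<close>

definition ereal_set_integral :: "'a measure \<Rightarrow> 'a set \<Rightarrow> ('a \<Rightarrow> ereal) \<Rightarrow> ereal" where
  "ereal_set_integral M A f =
     enn2ereal (\<integral>\<^sup>+x\<in>A. e2ennreal (f x) \<partial>M) - enn2ereal (\<integral>\<^sup>+x\<in>A. e2ennreal (- f x) \<partial>M)"

text \<open>
  The supremum is taken in the extended reals, so that it is \<open>\<infinity>\<close> on unbounded sets.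
  When it is at most \<open>lam\<close> and \<open>h_fun w\<close> is bounded and measurable, the integrand is
  bounded below, so the integral is well defined with value in $(-\infty, \infty]$.
\<close>

definition Lambda_fun :: "real \<Rightarrow> (real \<Rightarrow> real) \<Rightarrow> real \<Rightarrow> ereal" where
  "Lambda_fun lam w \<theta> =
     (if (SUP x\<in>{0..<1}. ereal (\<theta> * h_fun w x)) \<le> ereal lam
      then ereal_set_integral lborel {0..<1}
             (\<lambda>x. if \<theta> * h_fun w x = lam then \<infinity>
                  else ereal (ln (lam / (lam - \<theta> * h_fun w x))))
      else \<infinity>)"

definition sigma_sq :: "real \<Rightarrow> (real \<Rightarrow> real) \<Rightarrow> real" where
  "sigma_sq lam w = 1 / lam\<^sup>2 * (LINT x:{0..<1}|lborel. (w x)\<^sup>2 / (1 - x)\<^sup>2)"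

definition MD_rate :: "real \<Rightarrow> (real \<Rightarrow> real) \<Rightarrow> real \<Rightarrow> ereal" where
  "MD_rate lam w y =
     (if sigma_sq lam w = 0 then (if y = 0 then 0 else \<infinity>)
      else ereal (y\<^sup>2 / (2 * sigma_sq lam w)))"

end

theory Submission
  imports Defs
begin

text \<open>
  By memorylessness the normalised spacings of an exponential sample are i.i.d. exponential
  (Renyi), so \<open>C_stat w X n\<close> has the moment generating function
  \<open>\<Prod>k<n. 1 / (1 - t * h_fun w (k / n) / (n * lam))\<close>. Rescaling puts the arguments at order
  \<open>1 / sqrt (n * a n)\<close>, where only the quadratic term of the logarithm survives; it is a Riemann sum of
  \<open>(h_fun w)\<^sup>2\<close>. The limiting cumulant function \<open>sigma_sq lam w * \<theta>\<^sup>2 / 2\<close> is that of a Gaussian, and an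
  elementary form of the Gaertner-Ellis argument (Chernoff above, exponential tilting below) gives the
  large deviation principle.
\<close>

section \<open>Memorylessness of the exponential law\<close>

text \<open>The joint law of the spacings is never constructed. Only the exponential moment of their
  weighted sum is needed, and it satisfies a recursion obtained by integrating out the smallest
  observation. That recursion runs in nonnegative integrals, so integrability is an outcome of the
  computation and not a prerequisite. The delicate point of the expansion is the linear term: at
  speed \<open>1 / a n\<close> it has order \<open>sqrt (n * a n)\<close>, which diverges, so the
  centring has to remove it exactly. The mean is therefore read off the same generating function, as
  its derivative at 0, and the linear terms cancel identically. The remainder must be small
  uniformly in \<open>k\<close>; this rests on boundedness of \<open>h_fun w\<close>, which is where
  the linear decay of \<open>w\<close> at 1 enters. Since the limiting cumulant is a parabola, the
  optimal tilts are explicit and no convex duality is required.\<close>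

definition exp_law :: "real \<Rightarrow> real measure" where
  "exp_law l = density lborel (\<lambda>t. ennreal (exponential_density l t))"

lemma sets_exp_law [simp, measurable_cong]: "sets (exp_law l) = sets borel"
  by (simp add: exp_law_def)

lemma space_exp_law [simp]: "space (exp_law l) = UNIV"
  by (simp add: exp_law_def)

lemma prob_space_exp_law: "0 < l \<Longrightarrow> prob_space (exp_law l)"
  unfolding exp_law_def by (rule prob_space_exponential_density)

lemma product_sigma_finite_exp_law: "0 < l \<Longrightarrow> product_sigma_finite (\<lambda>_. exp_law l)"
  unfolding product_sigma_finite_def
  by (simp add: prob_space_exp_law prob_space_imp_sigma_finite)

lemma sets_PiM_exp_law [measurable_cong]:
  "sets (PiM I (\<lambda>_. exp_law l)) = sets (PiM I (\<lambda>_. borel))"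
  by (intro sets_PiM_cong) auto

lemma nn_integral_exp_law:
  assumes "f \<in> borel_measurable borel"
  shows "(\<integral>\<^sup>+ x. f x \<partial>exp_law l) = (\<integral>\<^sup>+ x. ennreal (exponential_density l x) * f x \<partial>lborel)"
  unfolding exp_law_def using assms by (subst nn_integral_density) auto

text \<open>Choosing between open and closed rays lets ties for the minimum be broken by index.\<close>

definition ray_above :: "bool \<Rightarrow> real \<Rightarrow> real set" where
  "ray_above b y = (if b then {y<..} else {y..})"

lemma ray_above_sets [measurable]: "ray_above b y \<in> sets borel"
  by (simp add: ray_above_def)

text \<open>Translation by \<open>y\<close> multiplies the density on the positive axis by
  \<open>exp (- l * y)\<close>. An arbitrary weight \<open>f\<close> is carried along because the
  recursion conditions functionals of the sample, not only events.\<close>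

lemma exp_law_memoryless:
  assumes f [measurable]: "f \<in> borel_measurable borel" and l: "0 < l" and y: "0 \<le> y"
  shows "(\<integral>\<^sup>+ x. f x * indicator (ray_above b y) x \<partial>exp_law l)
    = ennreal (exp (- l * y)) * (\<integral>\<^sup>+ x. f (x + y) \<partial>exp_law l)"
proof -
  have "(\<integral>\<^sup>+ x. f x * indicator (ray_above b y) x \<partial>exp_law l)
      = (\<integral>\<^sup>+ x. ennreal (exponential_density l x) * (f x * indicator (ray_above b y) x) \<partial>lborel)"
    by (rule nn_integral_exp_law) measurable
  also have "\<dots> = (\<integral>\<^sup>+ x. ennreal (exponential_density l (y + 1 * x)) *
      (f (y + 1 * x) * indicator (ray_above b y) (y + 1 * x)) \<partial>lborel)"
    by (subst nn_integral_real_affine[where c = 1 and t = y]) auto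
  also have "\<dots> = (\<integral>\<^sup>+ x. ennreal (exp (- l * y)) * (ennreal (exponential_density l x) * f (x + y)) \<partial>lborel)"
  proof (rule nn_integral_cong_AE)
    \<comment> \<open>At 0 the open and the closed ray differ; dropping this null point lets one
      computation serve both values of \<open>b\<close>.\<close>
    have "AE x in lborel. x \<noteq> (0::real)"
      by (rule AE_lborel_singleton)
    then show "AE x in lborel. ennreal (exponential_density l (y + 1 * x)) *
        (f (y + 1 * x) * indicator (ray_above b y) (y + 1 * x))
      = ennreal (exp (- l * y)) * (ennreal (exponential_density l x) * f (x + y))"
    proof eventually_elim
      case (elim x)
      show ?case
      proof (cases "x < 0")
        case True
        then show ?thesis
          using l by (simp add: exponential_density_def ray_above_def)
      next
        case False
        with elim have "0 < x" by simp
        then have "exponential_density l (y + x) = exp (- l * y) * exponential_density l x"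
          using y by (simp add: exponential_density_def exp_add[symmetric] algebra_simps)
        moreover have "indicator (ray_above b y) (y + x) = (1::ennreal)"
          using \<open>0 < x\<close> by (simp add: ray_above_def)
        ultimately show ?thesis
          using l by (simp add: ennreal_mult' exponential_density_nonneg mult.assoc add.commute)
      qed
    qed
  qed
  also have "\<dots> = ennreal (exp (- l * y)) * (\<integral>\<^sup>+ x. f (x + y) \<partial>exp_law l)"
    by (simp add: nn_integral_cmult nn_integral_exp_law)
  finally show ?thesis .
qed

text \<open>Fubini, one coordinate at a time, each surviving coordinate contributing one factor
  \<open>exp (- l * y)\<close>. The kind of ray varies with the coordinate, as breaking ties by
  index requires.\<close>

lemma PiM_exp_law_memoryless:
  fixes J :: "'i set"
  assumes "finite J" and l: "0 < l" and y: "0 \<le> y"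
    and "f \<in> borel_measurable (PiM J (\<lambda>_. borel))"
  shows "(\<integral>\<^sup>+ x. f x * (\<Prod>j\<in>J. indicator (ray_above (b j) y) (x j)) \<partial>PiM J (\<lambda>_. exp_law l))
    = ennreal (exp (- l * y)) ^ card J *
      (\<integral>\<^sup>+ x. f (\<lambda>j\<in>J. x j + y) \<partial>PiM J (\<lambda>_. exp_law l))"
  using assms(1,4)
proof (induction J arbitrary: f rule: finite_induct)
  case empty
  interpret product_sigma_finite "\<lambda>_::'i. exp_law l"
    using l by (rule product_sigma_finite_exp_law)
  show ?case by (simp add: PiM_empty nn_integral_count_space_finite restrict_def)
next
  case (insert i J)
  interpret product_sigma_finite "\<lambda>_::'i. exp_law l"
    using l by (rule product_sigma_finite_exp_law)
  note [measurable] = insert.prems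
  have [measurable]: "(\<lambda>x. \<lambda>j\<in>insert i J. x j + y) \<in> measurable (PiM (insert i J) (\<lambda>_. borel)) (PiM (insert i J) (\<lambda>_. borel))"
    by measurable
  have upd_snd: "(\<lambda>z. x(i := z)) \<in> measurable borel (PiM (insert i J) (\<lambda>_. borel))"
    if "x \<in> space (PiM J (\<lambda>_. borel::real measure))" for x
    using that by (intro measurable_fun_upd[where J = J]) auto
  have upd_pair: "(\<lambda>(x, z). x(i := z)) \<in> measurable (PiM J (\<lambda>_. borel) \<Otimes>\<^sub>M borel) (PiM (insert i J) (\<lambda>_. borel::real measure))"
    by (rule measurable_add_dim)
  let ?c = "ennreal (exp (- l * y))"
  let ?P = "\<lambda>J. PiM J (\<lambda>_::'i. exp_law l)"
  have spP: "space (?P J) = space (PiM J (\<lambda>_. borel::real measure))"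
    by (simp add: space_PiM)
  have meas_in: "(\<lambda>x. \<integral>\<^sup>+ z. f (x(i := z + y)) \<partial>exp_law l) \<in> borel_measurable (PiM J (\<lambda>_. borel))"
  proof (rule sigma_finite_measure.borel_measurable_nn_integral[OF prob_space_imp_sigma_finite[OF prob_space_exp_law[OF l]]])
    have "(\<lambda>(x, z). f ((\<lambda>(x, z). x(i := z)) (x, z + y))) \<in> borel_measurable (PiM J (\<lambda>_. borel) \<Otimes>\<^sub>M borel)"
      using upd_pair by measurable
    then show "case_prod (\<lambda>x z. f (x(i := z + y))) \<in> borel_measurable (PiM J (\<lambda>_. borel) \<Otimes>\<^sub>M exp_law l)"
      by (simp cong: measurable_cong_sets)
  qed
  have "(\<integral>\<^sup>+ x. f x * (\<Prod>j\<in>insert i J. indicator (ray_above (b j) y) (x j)) \<partial>?P (insert i J))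
    = (\<integral>\<^sup>+ x. \<integral>\<^sup>+ z. f (x(i := z)) * (\<Prod>j\<in>insert i J. indicator (ray_above (b j) y) ((x(i := z)) j)) \<partial>exp_law l \<partial>?P J)"
    by (rule product_nn_integral_insert[OF insert.hyps]) measurable
  also have "\<dots> = (\<integral>\<^sup>+ x. (?c * (\<integral>\<^sup>+ z. f (x(i := z + y)) \<partial>exp_law l)) *
       (\<Prod>j\<in>J. indicator (ray_above (b j) y) (x j)) \<partial>?P J)"
  proof (rule nn_integral_cong)
    fix x assume x: "x \<in> space (?P J)"
    have fm [measurable]: "(\<lambda>z. f (x(i := z))) \<in> borel_measurable borel"
      using upd_snd[of x] x by (simp add: spP)
    have "(\<Prod>j\<in>J. indicator (ray_above (b j) y) ((x(i := z)) j)) = (\<Prod>j\<in>J. indicator (ray_above (b j) y) (x j) :: ennreal)" for z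
      using insert.hyps by (intro prod.cong) auto
    then have "(\<integral>\<^sup>+ z. f (x(i := z)) * (\<Prod>j\<in>insert i J. indicator (ray_above (b j) y) ((x(i := z)) j)) \<partial>exp_law l)
      = (\<integral>\<^sup>+ z. (f (x(i := z)) * indicator (ray_above (b i) y) z) * (\<Prod>j\<in>J. indicator (ray_above (b j) y) (x j)) \<partial>exp_law l)"
      using insert.hyps by (simp add: mult.assoc)
    also have "\<dots> = (\<integral>\<^sup>+ z. (f (x(i := z)) * indicator (ray_above (b i) y) z) \<partial>exp_law l) * (\<Prod>j\<in>J. indicator (ray_above (b j) y) (x j))"
      by (rule nn_integral_multc) measurable
    also have "(\<integral>\<^sup>+ z. (f (x(i := z)) * indicator (ray_above (b i) y) z) \<partial>exp_law l) = ?c * (\<integral>\<^sup>+ z. f (x(i := z + y)) \<partial>exp_law l)"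
      by (rule exp_law_memoryless[OF fm l y])
    finally show "(\<integral>\<^sup>+ z. f (x(i := z)) * (\<Prod>j\<in>insert i J. indicator (ray_above (b j) y) ((x(i := z)) j)) \<partial>exp_law l)
      = (?c * (\<integral>\<^sup>+ z. f (x(i := z + y)) \<partial>exp_law l)) * (\<Prod>j\<in>J. indicator (ray_above (b j) y) (x j))" .
  qed
  \<comment> \<open>The induction hypothesis is applied to the function left after integrating out
    coordinate \<open>i\<close>; hence \<open>f\<close> is arbitrary in the induction, and
    \<open>meas_in\<close> is what makes it applicable.\<close>
  also have "\<dots> = ?c ^ card J * (\<integral>\<^sup>+ x. ?c * (\<integral>\<^sup>+ z. f ((\<lambda>j\<in>J. x j + y)(i := z + y)) \<partial>exp_law l) \<partial>?P J)"
    using meas_in by (intro insert.IH) measurable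
  also have "(\<integral>\<^sup>+ x. ?c * (\<integral>\<^sup>+ z. f ((\<lambda>j\<in>J. x j + y)(i := z + y)) \<partial>exp_law l) \<partial>?P J)
     = ?c * (\<integral>\<^sup>+ x. (\<integral>\<^sup>+ z. f ((\<lambda>j\<in>J. x j + y)(i := z + y)) \<partial>exp_law l) \<partial>?P J)"
  proof (rule nn_integral_cmult)
    have "(\<lambda>x. \<lambda>j\<in>J. x j + y) \<in> measurable (PiM J (\<lambda>_. borel)) (PiM J (\<lambda>_. borel))"
      by measurable
    from measurable_compose[OF this meas_in]
    show "(\<lambda>x. (\<integral>\<^sup>+ z. f ((\<lambda>j\<in>J. x j + y)(i := z + y)) \<partial>exp_law l)) \<in> borel_measurable (?P J)"
      by (simp cong: measurable_cong_sets add: sets_PiM_exp_law)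
  qed
  also have "(\<integral>\<^sup>+ x. (\<integral>\<^sup>+ z. f ((\<lambda>j\<in>J. x j + y)(i := z + y)) \<partial>exp_law l) \<partial>?P J)
    = (\<integral>\<^sup>+ x. \<integral>\<^sup>+ z. f (\<lambda>j\<in>insert i J. (x(i := z)) j + y) \<partial>exp_law l \<partial>?P J)"
    using insert.hyps by (intro nn_integral_cong arg_cong[where f = f]) auto
  also have "\<dots> = (\<integral>\<^sup>+ x. f (\<lambda>j\<in>insert i J. x j + y) \<partial>?P (insert i J))"
    by (rule product_nn_integral_insert[OF insert.hyps, symmetric]) measurable
  finally show ?case
    unfolding card_insert_disjoint[OF insert.hyps] power_Suc by (simp only: mult_ac)
qed

section \<open>Spacings of an exponential sample\<close>

text \<open>Carrying the preceding value \<open>p\<close> makes the rest of a sorted sample, once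
  its minimum is removed, an instance of the same function with shifted coefficients. Taking
  \<open>p = 0\<close> gives the convention for the zeroth order statistic.\<close>

primrec spacing_sum :: "(nat \<Rightarrow> real) \<Rightarrow> real \<Rightarrow> real list \<Rightarrow> real" where
  "spacing_sum c p [] = 0"
| "spacing_sum c p (x # xs) = c 0 * (x - p) + spacing_sum (\<lambda>k. c (Suc k)) x xs"

lemma spacing_sum_eq_sum:
  "spacing_sum c p xs = (\<Sum>k<length xs. c k * (xs ! k - (p # xs) ! k))"
proof (induction xs arbitrary: c p)
  case (Cons x xs)
  show ?case
    by (simp only: spacing_sum.simps Cons.IH length_Cons sum.lessThan_Suc_shift) simp
qed simp

text \<open>Only differences enter. This brings the base point back to 0 once memorylessness has
  rewritten the other values as minimum plus excess.\<close>

lemma spacing_sum_shift: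
  "spacing_sum c (p + y) (map (\<lambda>z. z + y) xs) = spacing_sum c p xs"
  by (induction xs arbitrary: c p) simp_all

section \<open>Order statistics over arbitrary finite index sets\<close>

text \<open>The index set is arbitrary so that the index of the minimum can be deleted; going
  through a multiset avoids choosing an enumeration of it.\<close>

definition sorted_vals :: "nat set \<Rightarrow> (nat \<Rightarrow> real) \<Rightarrow> real list" where
  "sorted_vals I x = sorted_list_of_multiset (image_mset x (mset_set I))"

lemma mset_sorted_vals [simp]: "mset (sorted_vals I x) = image_mset x (mset_set I)"
  by (simp add: sorted_vals_def)

lemma sorted_sorted_vals [simp]: "sorted (sorted_vals I x)"
  by (simp add: sorted_vals_def)

lemma length_sorted_vals [simp]: "length (sorted_vals I x) = card I"
  by (metis mset_sorted_vals size_image_mset size_mset size_mset_set)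

lemma sorted_vals_empty [simp]: "sorted_vals {} x = []"
  by (simp add: sorted_vals_def)

lemma sorted_vals_cong: "(\<And>i. i \<in> I \<Longrightarrow> x i = y i) \<Longrightarrow> sorted_vals I x = sorted_vals I y"
  by (cases "finite I") (auto simp: sorted_vals_def intro!: arg_cong[where f = sorted_list_of_multiset] image_mset_cong)

lemma sorted_vals_Cons:
  assumes "finite J" "i \<notin> J" "\<And>j. j \<in> J \<Longrightarrow> x i \<le> x j"
  shows "sorted_vals (insert i J) x = x i # sorted_vals J x"
proof -
  have "set_mset (image_mset x (mset_set J)) = x ` J"
    using assms by simp
  then have "\<forall>z\<in>set (sorted_vals J x). x i \<le> z"
    using assms by (metis (no_types, lifting) imageE mset_sorted_vals set_mset_mset)
  then have "insort (x i) (sorted_vals J x) = x i # sorted_vals J x"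
    by (intro insort_is_Cons) auto
  then show ?thesis
    using assms by (simp add: sorted_vals_def)
qed

lemma sorted_vals_shift:
  "sorted_vals J (\<lambda>j\<in>J. x j + y) = map (\<lambda>z. z + y) (sorted_vals J x)"
proof -
  have "sorted_vals J (\<lambda>j\<in>J. x j + y) = sorted_vals J (\<lambda>j. x j + y)"
    by (rule sorted_vals_cong) simp
  also have "\<dots> = sorted_list_of_multiset (mset (map (\<lambda>z. z + y) (sorted_vals J x)))"
    by (simp only: sorted_vals_def[of _ "\<lambda>j. x j + y"] mset_map mset_sorted_vals multiset.map_comp comp_def)
  also have "\<dots> = map (\<lambda>z. z + y) (sorted_vals J x)"
    unfolding sorted_list_of_multiset_mset
    by (rule sorted_sort_id) (simp add: sorted_map sorted_wrt_mono_rel[OF _ sorted_sorted_vals])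
  finally show ?thesis .
qed

text \<open>The entries at most \<open>t\<close> form an initial segment of a sorted list. An event
  about an order statistic thus becomes a count of coordinates, which is visibly measurable.\<close>

lemma sorted_nth_le_iff:
  assumes "sorted xs" "k < length xs"
  shows "xs ! k \<le> t \<longleftrightarrow> k < length (filter (\<lambda>z. z \<le> t) xs)"
  using assms
proof (induction xs arbitrary: k)
  case (Cons x xs)
  show ?case
  proof (cases "x \<le> t")
    case True
    then show ?thesis using Cons by (cases k) auto
  next
    case False
    then have *: "\<forall>z\<in>set xs. \<not> z \<le> t" using Cons.prems by auto
    then have "filter (\<lambda>z. z \<le> t) (x # xs) = []" using False by (auto simp: filter_empty_conv)
    moreover have "\<not> (x # xs) ! k \<le> t" using Cons.prems(2) False * by (cases k) auto
    ultimately show ?thesis by simp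
  qed
qed simp

lemma sorted_vals_measurable:
  assumes "finite I" "k < card I"
  shows "(\<lambda>x. sorted_vals I x ! k) \<in> borel_measurable (PiM I (\<lambda>_. borel))"
proof (rule borel_measurableI_le)
  fix t :: real
  have "sorted_vals I x ! k \<le> t \<longleftrightarrow> k < card {i. i \<in> I \<and> x i \<le> t}" for x
  proof -
    have "length (filter (\<lambda>z. z \<le> t) (sorted_vals I x)) = size (filter_mset (\<lambda>z. z \<le> t) (image_mset x (mset_set I)))"
      by (metis mset_filter mset_sorted_vals size_mset)
    also have "\<dots> = card {i. i \<in> I \<and> x i \<le> t}"
      using assms by (simp add: filter_mset_image_mset filter_mset_mset_set)
    finally show ?thesis
      using assms by (subst sorted_nth_le_iff) auto
  qed
  moreover have "{x \<in> space (PiM I (\<lambda>_. borel)). k < card {i. i \<in> I \<and> x i \<le> t}} \<in> sets (PiM I (\<lambda>_. borel::real measure))"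
  proof -
    have [measurable]: "Measurable.pred (PiM I (\<lambda>_. borel)) (\<lambda>x. i \<in> I \<and> x i \<le> t)" for i
      by (cases "i \<in> I") auto
    show ?thesis by measurable
  qed
  ultimately show "{x \<in> space (PiM I (\<lambda>_. borel)). sorted_vals I x ! k \<le> t} \<in> sets (PiM I (\<lambda>_. borel::real measure))"
    by simp
qed

lemma spacing_sum_measurable:
  assumes "finite I"
  shows "(\<lambda>x. spacing_sum c p (sorted_vals I x)) \<in> borel_measurable (PiM I (\<lambda>_. borel))"
proof -
  have "(\<lambda>x. c k * (sorted_vals I x ! k - (p # sorted_vals I x) ! k)) \<in> borel_measurable (PiM I (\<lambda>_. borel))"
    if "k < card I" for k
    using that assms by (cases k) (auto intro!: borel_measurable_times borel_measurable_diff sorted_vals_measurable)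
  then show ?thesis
    by (auto simp: spacing_sum_eq_sum)
qed

section \<open>Recursion for the exponential moment of the spacings\<close>

text \<open>Each product is the indicator of \<open>i\<close> being the first index at which the
  minimum is attained: earlier indices must lie strictly above, later ones may tie. The pieces form
  a pointwise partition, so no null set of ties has to be discarded.\<close>

lemma sum_first_min_indicators:
  fixes x :: "nat \<Rightarrow> real"
  assumes I: "finite I" "I \<noteq> {}"
  shows "(\<Sum>i\<in>I. \<Prod>j\<in>I - {i}. indicator (ray_above (j < i) (x i)) (x j) :: ennreal) = 1"
proof -
  define m where "m = Min (x ` I)"
  define i0 where "i0 = Min {i\<in>I. x i = m}"
  have m: "m \<in> x ` I" "\<And>j. j \<in> I \<Longrightarrow> m \<le> x j"
    using I by (auto simp: m_def)
  have "i0 \<in> {i\<in>I. x i = m}"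
    unfolding i0_def using I m by (intro Min_in) auto
  then have i0: "i0 \<in> I" "x i0 = m" by auto
  have i0_le: "i0 \<le> j" if "j \<in> I" "x j = m" for j
    unfolding i0_def using I that by (intro Min_le) auto
  have eq: "(\<Prod>j\<in>I - {i}. indicator (ray_above (j < i) (x i)) (x j) :: ennreal) = (if i = i0 then 1 else 0)"
    if i: "i \<in> I" for i
  proof (cases "i = i0")
    case True
    have "x j \<in> ray_above (j < i) (x i)" if "j \<in> I - {i}" for j
      using that m(2)[of j] i0 i0_le[of j] True by (auto simp: ray_above_def less_le)
    then show ?thesis using True by simp
  next
    case False
    \<comment> \<open>If \<open>i0 < i\<close>, strictness fails because \<open>x i0\<close> is
      minimal; if \<open>i < i0\<close>, membership would make \<open>i\<close> an earlier
      minimiser.\<close>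
    have "x i0 \<notin> ray_above (i0 < i) (x i)"
      using False m(2)[of i] i i0 i0_le[of i] by (auto simp: ray_above_def)
    then have "\<exists>j\<in>I - {i}. indicator (ray_above (j < i) (x i)) (x j) = (0::ennreal)"
      using False i0 by (intro bexI[of _ i0]) auto
    then show ?thesis using False I by (simp add: prod_zero)
  qed
  have "(\<Sum>i\<in>I. \<Prod>j\<in>I - {i}. indicator (ray_above (j < i) (x i)) (x j) :: ennreal) = (\<Sum>i\<in>I. if i = i0 then 1 else 0)"
    by (rule sum.cong) (simp_all add: eq)
  also have "\<dots> = 1" using I i0 by simp
  finally show ?thesis .
qed

text \<open>Up to the factor \<open>l / (l - u)\<close>, the tilted density is the exponential
  density of rate \<open>l - u\<close>, whose total mass is already known to be 1.\<close>

lemma nn_integral_exp_exp_law: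
  assumes l: "0 < l" and u: "u < l"
  shows "(\<integral>\<^sup>+ x. ennreal (exp (u * x)) \<partial>exp_law l) = ennreal (l / (l - u))"
proof -
  have "(\<integral>\<^sup>+ x. ennreal (exp (u * x)) \<partial>exp_law l)
      = (\<integral>\<^sup>+ x. ennreal (l / (l - u)) * (ennreal (exponential_density (l - u) x) * 1) \<partial>lborel)"
    unfolding nn_integral_exp_law[of "\<lambda>x. ennreal (exp (u * x))", simplified]
  proof (rule nn_integral_cong)
    fix x :: real
    have "exponential_density l x * exp (u * x) = l / (l - u) * exponential_density (l - u) x"
    proof -
      have "exp (- x * l) * exp (u * x) = exp (- x * (l - u))"
        by (simp add: mult_exp_exp algebra_simps)
      then show ?thesis using u by (simp add: exponential_density_def mult.assoc)
    qed
    then show "ennreal (exponential_density l x) * ennreal (exp (u * x))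
      = ennreal (l / (l - u)) * (ennreal (exponential_density (l - u) x) * 1)"
      using l u by (simp add: ennreal_mult'[symmetric] exponential_density_nonneg)
  qed
  also have "\<dots> = ennreal (l / (l - u)) * (\<integral>\<^sup>+ x. 1 \<partial>exp_law (l - u))"
    by (subst nn_integral_exp_law) (auto simp: nn_integral_cmult)
  also have "\<dots> = ennreal (l / (l - u))"
    using prob_space.emeasure_space_1[OF prob_space_exp_law[of "l - u"]] u by simp
  finally show ?thesis .
qed

lemma AE_exp_law_nonneg: "AE y in exp_law l. 0 \<le> y"
  unfolding exp_law_def by (subst AE_density) (auto simp: exponential_density_def)

text \<open>
  Conditionally on which variable is the smallest and on its value, the excesses of the others
  are again i.i.d. exponential; this peels off one factor.
\<close>

lemma nn_integral_exp_spacing_sum: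
  assumes l: "0 < l" and "finite I" "card I = n" "\<And>k. k < n \<Longrightarrow> c k < real (n - k) * l"
  shows "(\<integral>\<^sup>+ x. ennreal (exp (spacing_sum c 0 (sorted_vals I x))) \<partial>PiM I (\<lambda>_. exp_law l))
    = ennreal (\<Prod>k<n. real (n - k) * l / (real (n - k) * l - c k))"
  using assms(2-)
proof (induction n arbitrary: I c)
  case 0
  then have "I = {}" by simp
  then show ?case by (simp add: PiM_empty nn_integral_count_space_finite)
next
  case (Suc n)
  interpret product_sigma_finite "\<lambda>_::nat. exp_law l"
    using l by (rule product_sigma_finite_exp_law)
  let ?P = "\<lambda>I. PiM I (\<lambda>_::nat. exp_law l)"
  let ?c' = "\<lambda>k. c (Suc k)"
  let ?f = "\<lambda>I x. ennreal (exp (spacing_sum c 0 (sorted_vals I x)))"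
  let ?ind = "\<lambda>i x. \<Prod>j\<in>I - {i}. indicator (ray_above (j < i) (x i)) (x j) :: ennreal"
  \<comment> \<open>The moment that the induction hypothesis assigns to the \<open>n\<close>
    variables left after removing the minimum, with coefficients shifted by one.\<close>
  define G where "G = (\<Prod>k<n. real (n - k) * l / (real (n - k) * l - c (Suc k)))"
  have c': "?c' k < real (n - k) * l" if "k < n" for k
    using Suc.prems(3)[of "Suc k"] that by simp
  have G0: "0 \<le> G" unfolding G_def using c' l by (intro prod_nonneg) (auto simp: less_imp_le)
  have I0: "I \<noteq> {}" using Suc.prems by auto
  have f [measurable]: "?f I \<in> borel_measurable (?P I)"
    using spacing_sum_measurable[OF Suc.prems(1), of c 0] by measurable
  have ind_meas [measurable]: "?ind i \<in> borel_measurable (?P I)" if [measurable]: "i \<in> I" for i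
  proof (rule borel_measurable_prod_ennreal)
    fix j assume "j \<in> I - {i}"
    then have [measurable]: "j \<in> I" by simp
    \<comment> \<open>The ray moves with \<open>x i\<close>; testing the difference
      \<open>x j - x i\<close> against a fixed ray makes measurability accessible.\<close>
    have *: "indicator (ray_above (j < i) (x i)) (x j) = (if j < i then indicator {0<..} (x j - x i) else indicator {0..} (x j - x i) :: ennreal)" for x :: "nat \<Rightarrow> real"
      by (auto simp: ray_above_def indicator_def)
    show "(\<lambda>x. indicator (ray_above (j < i) (x i)) (x j) :: ennreal) \<in> borel_measurable (?P I)"
      unfolding * by measurable
  qed
  have one: "(\<integral>\<^sup>+ x. ?f I x * ?ind i x \<partial>?P I) = ennreal (l / (real (Suc n) * l - c 0) * G)" if i: "i \<in> I" for i
  proof -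
    define J where "J = I - {i}"
    have J: "finite J" "i \<notin> J" "I = insert i J" "card J = n"
      using Suc.prems i by (auto simp: J_def)
    have inner: "(\<integral>\<^sup>+ x. ?f I (x(i := y)) * ?ind i (x(i := y)) \<partial>?P J) = ennreal (exp ((c 0 - real n * l) * y) * G)"
      if y: "0 \<le> y" for y
    proof -
      have "(\<integral>\<^sup>+ x. ?f I (x(i := y)) * ?ind i (x(i := y)) \<partial>?P J)
        = (\<integral>\<^sup>+ x. ennreal (exp (c 0 * y)) * ennreal (exp (spacing_sum ?c' y (sorted_vals J x)))
             * (\<Prod>j\<in>J. indicator (ray_above (j < i) y) (x j)) \<partial>?P J)"
      proof (rule nn_integral_cong)
        fix x
        have ind: "?ind i (x(i := y)) = (\<Prod>j\<in>J. indicator (ray_above (j < i) y) (x j))"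
          unfolding J_def by (rule prod.cong) simp_all
        show "?f I (x(i := y)) * ?ind i (x(i := y)) = ennreal (exp (c 0 * y)) * ennreal (exp (spacing_sum ?c' y (sorted_vals J x)))
             * (\<Prod>j\<in>J. indicator (ray_above (j < i) y) (x j))"
        \<comment> \<open>If all other values lie in their rays, \<open>y\<close> heads the sorted
          list; otherwise both sides vanish.\<close>
        proof (cases "\<forall>j\<in>J. x j \<in> ray_above (j < i) y")
          case True
          have "y \<le> x j" if "j \<in> J" for j
          proof -
            have "x j \<in> ray_above (j < i) y" using True that by blast
            then show ?thesis by (cases "j < i") (simp_all add: ray_above_def)
          qed
          then have "sorted_vals I (x(i := y)) = (x(i := y)) i # sorted_vals J (x(i := y))"
            using sorted_vals_Cons[OF J(1,2), of "x(i := y)"] J(2) by (subst J(3)) auto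
          also have "sorted_vals J (x(i := y)) = sorted_vals J x"
            using J(2) by (intro sorted_vals_cong) auto
          finally have "sorted_vals I (x(i := y)) = y # sorted_vals J x"
            by (simp only: fun_upd_same)
          then show ?thesis
            unfolding ind by (simp only: spacing_sum.simps exp_add ennreal_mult exp_ge_zero diff_0_right)
        next
          case False
          then obtain j where "j \<in> J" "x j \<notin> ray_above (j < i) y" by blast
          then have "(\<Prod>j\<in>J. indicator (ray_above (j < i) y) (x j)) = (0::ennreal)"
            using J(1) by (intro prod_zero bexI[of _ j]) simp_all
          then show ?thesis unfolding ind by (simp only: mult_zero_right)
        qed
      qed
      also have "\<dots> = ennreal (exp (- l * y)) ^ card J * (\<integral>\<^sup>+ x. ennreal (exp (c 0 * y)) *
          ennreal (exp (spacing_sum ?c' y (sorted_vals J (\<lambda>j\<in>J. x j + y)))) \<partial>?P J)"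
        using spacing_sum_measurable[OF J(1), of ?c' y]
        by (intro PiM_exp_law_memoryless[OF J(1) l y]) measurable
      also have "(\<integral>\<^sup>+ x. ennreal (exp (c 0 * y)) *
          ennreal (exp (spacing_sum ?c' y (sorted_vals J (\<lambda>j\<in>J. x j + y)))) \<partial>?P J)
        = (\<integral>\<^sup>+ x. ennreal (exp (c 0 * y)) * ennreal (exp (spacing_sum ?c' 0 (sorted_vals J x))) \<partial>?P J)"
        using spacing_sum_shift[of ?c' 0 y] by (simp add: sorted_vals_shift)
      also have "\<dots> = ennreal (exp (c 0 * y)) * (\<integral>\<^sup>+ x. ennreal (exp (spacing_sum ?c' 0 (sorted_vals J x))) \<partial>?P J)"
        using spacing_sum_measurable[OF J(1), of ?c' 0] by (intro nn_integral_cmult) measurable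
      also have "(\<integral>\<^sup>+ x. ennreal (exp (spacing_sum ?c' 0 (sorted_vals J x))) \<partial>?P J) = ennreal G"
        unfolding G_def by (rule Suc.IH[OF J(1,4) c'])
      also have "ennreal (exp (- l * y)) ^ card J * (ennreal (exp (c 0 * y)) * ennreal G)
          = ennreal (exp (- l * y) ^ n * (exp (c 0 * y) * G))"
        unfolding J(4) by (simp add: ennreal_power ennreal_mult G0)
      also have "exp (- l * y) ^ n * (exp (c 0 * y) * G) = exp ((c 0 - real n * l) * y) * G"
      proof -
        have "(c 0 - real n * l) * y = real n * (- l * y) + c 0 * y"
          by (simp add: algebra_simps)
        then show ?thesis
          by (simp only: exp_add exp_of_nat_mult mult.assoc)
      qed
      finally show ?thesis .
    qed
    \<comment> \<open>The minimum is integrated last. The survival factors of the other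
      \<open>n\<close> variables lower its exponent by \<open>real n * l\<close>, so its effective
      rate is \<open>real (Suc n) * l - c 0\<close>.\<close>
    have "(\<integral>\<^sup>+ x. ?f I x * ?ind i x \<partial>?P I) = (\<integral>\<^sup>+ y. \<integral>\<^sup>+ x. ?f I (x(i := y)) * ?ind i (x(i := y)) \<partial>?P J \<partial>exp_law l)"
      using product_nn_integral_insert_rev[OF J(1,2), of "\<lambda>x. ?f I x * ?ind i x"] i
      unfolding J(3)[symmetric] by measurable
    also have "\<dots> = (\<integral>\<^sup>+ y. ennreal (exp ((c 0 - real n * l) * y)) * ennreal G \<partial>exp_law l)"
      using AE_exp_law_nonneg[of l]
      by (intro nn_integral_cong_AE, eventually_elim) (simp only: inner ennreal_mult[OF _ G0] exp_ge_zero)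
    also have "\<dots> = (\<integral>\<^sup>+ y. ennreal (exp ((c 0 - real n * l) * y)) \<partial>exp_law l) * ennreal G"
      by (rule nn_integral_multc) measurable
    also have "(\<integral>\<^sup>+ y. ennreal (exp ((c 0 - real n * l) * y)) \<partial>exp_law l) = ennreal (l / (l - (c 0 - real n * l)))"
      using Suc.prems(3)[of 0] by (intro nn_integral_exp_exp_law[OF l]) (simp add: algebra_simps)
    finally show ?thesis
      using Suc.prems(3)[of 0] l G0 by (simp add: ennreal_mult'[symmetric] algebra_simps)
  qed
  have "(\<integral>\<^sup>+ x. ?f I x \<partial>?P I) = (\<integral>\<^sup>+ x. (\<Sum>i\<in>I. ?f I x * ?ind i x) \<partial>?P I)"
    by (intro nn_integral_cong)
       (simp only: sum_distrib_left[symmetric] sum_first_min_indicators[OF Suc.prems(1) I0] mult_1_right)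
  also have "\<dots> = (\<Sum>i\<in>I. \<integral>\<^sup>+ x. ?f I x * ?ind i x \<partial>?P I)"
    by (rule nn_integral_sum) measurable
  also have "\<dots> = (\<Sum>i\<in>I. ennreal (l / (real (Suc n) * l - c 0) * G))"
    by (rule sum.cong) (simp_all only: one)
  also have "\<dots> = ennreal (\<Sum>i\<in>I. l / (real (Suc n) * l - c 0) * G)"
    using Suc.prems(3)[of 0] l G0 by (intro sum_ennreal) simp
  \<comment> \<open>All \<open>Suc n\<close> candidates for the minimum contribute equally; adding
    them supplies the numerator \<open>real (Suc n) * l\<close> of the factor at
    \<open>k = 0\<close>.\<close>
  also have "(\<Sum>i\<in>I. l / (real (Suc n) * l - c 0) * G) = (\<Prod>k<Suc n. real (Suc n - k) * l / (real (Suc n - k) * l - c k))"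
    unfolding prod.lessThan_Suc_shift G_def using Suc.prems(2) by (simp add: mult.assoc)
  finally show ?case .
qed

section \<open>Large deviations from Gaussian cumulant asymptotics\<close>

definition gauss_rate :: "real \<Rightarrow> real \<Rightarrow> ereal" where
  "gauss_rate s y = (if s = 0 then (if y = 0 then 0 else \<infinity>) else ereal (y\<^sup>2 / (2 * s)))"

lemma MD_rate_eq: "MD_rate lam w = gauss_rate (sigma_sq lam w)"
  by (simp add: MD_rate_def gauss_rate_def fun_eq_iff)

lemma gauss_rate_nonneg: "0 \<le> s \<Longrightarrow> 0 \<le> gauss_rate s y"
  by (simp add: gauss_rate_def)

text \<open>For \<open>s = 0\<close> the radius degenerates to 0, so one formula covers both cases.
  Compactness of these balls gives goodness, and their closedness gives lower
  semicontinuity.\<close>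

lemma gauss_rate_level_set:
  assumes "0 \<le> s" "0 \<le> \<eta>"
  shows "{x. gauss_rate s x \<le> ereal \<eta>} = cball 0 (sqrt (2 * s * \<eta>))"
proof (cases "s = 0")
  case True
  then show ?thesis using assms by (auto simp: gauss_rate_def split: if_splits)
next
  case False
  with assms have s: "0 < s" by simp
  have iff: "x\<^sup>2 / (2 * s) \<le> \<eta> \<longleftrightarrow> \<bar>x\<bar> \<le> sqrt (2 * s * \<eta>)" for x
  proof -
    have "x\<^sup>2 / (2 * s) \<le> \<eta> \<longleftrightarrow> x\<^sup>2 \<le> 2 * s * \<eta>"
      using s by (simp add: field_simps)
    also have "\<dots> \<longleftrightarrow> sqrt (x\<^sup>2) \<le> sqrt (2 * s * \<eta>)"
      by (simp only: real_sqrt_le_iff)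
    finally show ?thesis by (simp only: real_sqrt_abs)
  qed
  show ?thesis
    by (intro set_eqI) (simp only: mem_Collect_eq gauss_rate_def False if_False ereal_less_eq(3)
      iff mem_cball dist_0_norm real_norm_def)
qed

lemma good_rate_gauss: "0 \<le> s \<Longrightarrow> good_rate (gauss_rate s)"
  by (simp add: good_rate_def gauss_rate_level_set)

lemma lower_semicont_gauss:
  assumes s: "0 \<le> s"
  shows "lower_semicont (gauss_rate s)"
  unfolding lower_semicont_def
proof
  fix x
  show "gauss_rate s x \<le> Liminf (at x) (gauss_rate s)"
  proof (rule le_Liminf_iff[THEN iffD2], intro allI impI)
    fix c assume c: "c < gauss_rate s x"
    show "eventually (\<lambda>y. c < gauss_rate s y) (at x)"
    proof (cases "c < 0")
      case True
      then have "c < gauss_rate s y" for y using gauss_rate_nonneg[OF s] by (rule less_le_trans)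
      then show ?thesis by simp
    next
      case False
      then obtain \<eta> where \<eta>: "c = ereal \<eta>" "0 \<le> \<eta>"
        using c by (cases c) auto
      have "open (- {y. gauss_rate s y \<le> c})"
        unfolding \<eta>(1) gauss_rate_level_set[OF s \<eta>(2)] by (simp add: open_Compl)
      moreover have "x \<in> - {y. gauss_rate s y \<le> c}" using c by auto
      ultimately have "eventually (\<lambda>y. y \<in> - {y. gauss_rate s y \<le> c}) (nhds x)"
        by (rule eventually_nhds_in_open)
      then show ?thesis
        unfolding eventually_at_filter by (rule eventually_mono) auto
    qed
  qed
qed

section \<open>Exponential bounds for a single random variable\<close>

text \<open>Chernoff's bound. Assuming \<open>r \<le> t * Z x\<close> on \<open>A\<close>, instead
  of fixing the sign of \<open>t\<close>, lets it serve both tails.\<close>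

lemma (in prob_space) prob_le_exp_moment:
  assumes [measurable]: "Z \<in> borel_measurable M" and A [measurable]: "A \<in> events"
    and int: "integrable M (\<lambda>x. exp (t * Z x))"
    and le: "\<And>x. x \<in> A \<Longrightarrow> r \<le> t * Z x"
  shows "prob A \<le> exp (- r) * expectation (\<lambda>x. exp (t * Z x))"
proof -
  have "prob A = expectation (indicator A)"
    by simp
  also have "\<dots> \<le> expectation (\<lambda>x. exp (- r) * exp (t * Z x))"
  proof (rule integral_mono)
    fix x assume "x \<in> space M"
    show "indicator A x \<le> exp (- r) * exp (t * Z x)"
      using le[of x] by (auto simp: indicator_def mult_exp_exp)
  qed (use int in \<open>auto intro!: integrable_real_indicator simp: less_top[symmetric]\<close>)
  finally show ?thesis by simp
qed

text \<open>
  Cramer's change of measure without the measure: under the density proportional to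
  \<open>exp (t * Z)\<close>, Chernoff's bound with parameter \<open>r\<close> controls both sides of the ball.
\<close>

lemma (in prob_space) tilted_tail_le:
  assumes [measurable]: "Z \<in> borel_measurable M"
    and int: "integrable M (\<lambda>x. exp (t * Z x))" "integrable M (\<lambda>x. exp ((t + r) * Z x))"
      "integrable M (\<lambda>x. exp ((t - r) * Z x))"
    and r: "0 \<le> r"
  shows "exp (- (t * y + \<bar>t\<bar> * \<delta>)) * (expectation (\<lambda>x. exp (t * Z x))
      - exp (- r * (y + \<delta>)) * expectation (\<lambda>x. exp ((t + r) * Z x))
      - exp (r * (y - \<delta>)) * expectation (\<lambda>x. exp ((t - r) * Z x)))
    \<le> prob {x\<in>space M. Z x \<in> ball y \<delta>}"
proof -
  define A where "A = {x\<in>space M. Z x \<in> ball y \<delta>}"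
  have "ball y \<delta> \<in> sets borel" by simp
  then have A: "A \<in> events" unfolding A_def by measurable
  then have iA: "integrable M (indicator A :: 'a \<Rightarrow> real)"
    by (auto intro!: integrable_real_indicator simp: less_top[symmetric])
  have "expectation (\<lambda>x. exp (t * Z x)) \<le> expectation (\<lambda>x. exp (t * y + \<bar>t\<bar> * \<delta>) * indicator A x
      + exp (- r * (y + \<delta>)) * exp ((t + r) * Z x) + exp (r * (y - \<delta>)) * exp ((t - r) * Z x))"
  proof (rule integral_mono)
    fix x assume x: "x \<in> space M"
    have *: "exp (- r * (y + \<delta>)) * exp ((t + r) * Z x) = exp (t * Z x) * exp (r * (Z x - (y + \<delta>)))"
      "exp (r * (y - \<delta>)) * exp ((t - r) * Z x) = exp (t * Z x) * exp (r * (y - \<delta> - Z x))"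
      by (simp_all add: mult_exp_exp algebra_simps)
    \<comment> \<open>In each of the three regions one summand alone dominates
      \<open>exp (t * Z x)\<close>: inside the ball by the size of the tilt, outside because the
      extra exponential factor in \<open>*\<close> is at least 1.\<close>
    have "Z x \<in> ball y \<delta> \<or> y + \<delta> \<le> Z x \<or> Z x \<le> y - \<delta>"
      unfolding mem_ball dist_real_def by linarith
    then consider "Z x \<in> ball y \<delta>" | "y + \<delta> \<le> Z x" | "Z x \<le> y - \<delta>"
      by blast
    then show "exp (t * Z x) \<le> exp (t * y + \<bar>t\<bar> * \<delta>) * indicator A x
      + exp (- r * (y + \<delta>)) * exp ((t + r) * Z x) + exp (r * (y - \<delta>)) * exp ((t - r) * Z x)"
    proof cases
      case 1
      have "t * (Z x - y) \<le> \<bar>t\<bar> * \<bar>Z x - y\<bar>" by (metis abs_ge_self abs_mult)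
      also have "\<dots> \<le> \<bar>t\<bar> * \<delta>" using 1 by (intro mult_left_mono) (auto simp: dist_real_def)
      finally have "exp (t * Z x) \<le> exp (t * y + \<bar>t\<bar> * \<delta>)" by (simp add: algebra_simps)
      then show ?thesis using 1 x by (simp add: A_def add_increasing2)
    next
      case 2
      then have "exp (t * Z x) * 1 \<le> exp (t * Z x) * exp (r * (Z x - (y + \<delta>)))"
        using r by (intro mult_left_mono) auto
      then show ?thesis unfolding * by (simp add: add_increasing add_increasing2)
    next
      case 3
      then have "exp (t * Z x) * 1 \<le> exp (t * Z x) * exp (r * (y - \<delta> - Z x))"
        using r by (intro mult_left_mono) auto
      then show ?thesis unfolding * by (simp add: add_increasing add_increasing2)
    qed
  qed (use int iA in auto)
  also have "\<dots> = exp (t * y + \<bar>t\<bar> * \<delta>) * prob A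
      + exp (- r * (y + \<delta>)) * expectation (\<lambda>x. exp ((t + r) * Z x))
      + exp (r * (y - \<delta>)) * expectation (\<lambda>x. exp ((t - r) * Z x))"
    using int iA A by simp
  finally have "expectation (\<lambda>x. exp (t * Z x))
      - exp (- r * (y + \<delta>)) * expectation (\<lambda>x. exp ((t + r) * Z x))
      - exp (r * (y - \<delta>)) * expectation (\<lambda>x. exp ((t - r) * Z x)) \<le> exp (t * y + \<bar>t\<bar> * \<delta>) * prob A"
    by simp
  then have "exp (- (t * y + \<bar>t\<bar> * \<delta>)) * (expectation (\<lambda>x. exp (t * Z x))
      - exp (- r * (y + \<delta>)) * expectation (\<lambda>x. exp ((t + r) * Z x))
      - exp (r * (y - \<delta>)) * expectation (\<lambda>x. exp ((t - r) * Z x)))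
     \<le> exp (- (t * y + \<bar>t\<bar> * \<delta>)) * (exp (t * y + \<bar>t\<bar> * \<delta>) * prob A)"
    by (intro mult_left_mono) auto
  also have "\<dots> = prob A"
    by (simp add: mult.assoc[symmetric] mult_exp_exp)
  finally show ?thesis unfolding A_def .
qed

section \<open>Upper and lower bounds from the cumulants\<close>

text \<open>Moments are only asked to exist eventually, with a threshold depending on
  \<open>t\<close>: exponential variables have exponential moments only on a restricted range, which
  the scaled argument may enter only for large \<open>n\<close>.\<close>

locale gaussian_moments = prob_space +
  fixes Z :: "nat \<Rightarrow> 'a \<Rightarrow> real" and a :: "nat \<Rightarrow> real" and s :: real
  assumes Z_meas: "\<And>n. n \<ge> 1 \<Longrightarrow> Z n \<in> borel_measurable M"
    and a_pos: "\<And>n. n \<ge> 1 \<Longrightarrow> 0 < a n" and a_lim: "a \<longlonglongrightarrow> 0" and s_nonneg: "0 \<le> s"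
    and moments: "\<And>t. \<exists>L. (\<forall>\<^sub>F n in sequentially. integrable M (\<lambda>x. exp (t / a n * Z n x)) \<and>
        expectation (\<lambda>x. exp (t / a n * Z n x)) = exp (L n / a n)) \<and> L \<longlonglongrightarrow> s * t\<^sup>2 / 2"
begin

lemma eventually_a_pos: "\<forall>\<^sub>F n in sequentially. 0 < a n"
  using eventually_ge_at_top[of 1] by eventually_elim (rule a_pos)

lemma eventually_moment_bounds:
  assumes "0 < \<eta>"
  shows "\<forall>\<^sub>F n in sequentially. integrable M (\<lambda>x. exp (t / a n * Z n x)) \<and>
    exp ((s * t\<^sup>2 / 2 - \<eta>) / a n) \<le> expectation (\<lambda>x. exp (t / a n * Z n x)) \<and>
    expectation (\<lambda>x. exp (t / a n * Z n x)) \<le> exp ((s * t\<^sup>2 / 2 + \<eta>) / a n)"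
proof -
  obtain L where L: "\<forall>\<^sub>F n in sequentially. integrable M (\<lambda>x. exp (t / a n * Z n x)) \<and>
        expectation (\<lambda>x. exp (t / a n * Z n x)) = exp (L n / a n)" and lim: "L \<longlonglongrightarrow> s * t\<^sup>2 / 2"
    using moments by blast
  have "\<forall>\<^sub>F n in sequentially. dist (L n) (s * t\<^sup>2 / 2) < \<eta>"
    using lim assms by (rule tendstoD)
  with L eventually_a_pos show ?thesis
  proof eventually_elim
    case (elim n)
    then show ?case
      by (auto simp: dist_real_def abs_if divide_simps split: if_splits)
  qed
qed

text \<open>Chernoff with parameters \<open>t\<close> and \<open>-t\<close> on the two half lines.
  The limiting cumulant is even, so both sides obey the same bound, and the factor 2 from adding
  them disappears at speed \<open>1 / a n\<close>.\<close>

lemma tail_limsup_le: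
  assumes t: "0 \<le> t" and C [measurable]: "C \<in> sets borel" and b: "\<And>x. x \<in> C \<Longrightarrow> b \<le> \<bar>x\<bar>"
  shows "limsup (\<lambda>n. ereal (a n) * ext_log (prob {\<omega> \<in> space M. Z n \<omega> \<in> C}))
    \<le> ereal (s * t\<^sup>2 / 2 - t * b)"
proof (rule ereal_le_epsilon2)
  fix e :: real assume e: "0 < e"
  have "(\<lambda>n. a n * ln 2) \<longlonglongrightarrow> 0"
    using tendsto_mult_right[OF a_lim, of "ln 2"] by (simp add: mult.commute)
  then have "\<forall>\<^sub>F n in sequentially. a n * ln 2 < e / 2"
    by (rule order_tendstoD(2)) (use e in auto)
  moreover have "\<forall>\<^sub>F n in sequentially. integrable M (\<lambda>x. exp (t / a n * Z n x)) \<and>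
    exp ((s * t\<^sup>2 / 2 - e/2) / a n) \<le> expectation (\<lambda>x. exp (t / a n * Z n x)) \<and>
    expectation (\<lambda>x. exp (t / a n * Z n x)) \<le> exp ((s * t\<^sup>2 / 2 + e/2) / a n)"
    using e by (intro eventually_moment_bounds) auto
  moreover have "\<forall>\<^sub>F n in sequentially. integrable M (\<lambda>x. exp (-t / a n * Z n x)) \<and>
    exp ((s * (-t)\<^sup>2 / 2 - e/2) / a n) \<le> expectation (\<lambda>x. exp (-t / a n * Z n x)) \<and>
    expectation (\<lambda>x. exp (-t / a n * Z n x)) \<le> exp ((s * (-t)\<^sup>2 / 2 + e/2) / a n)"
    using e by (intro eventually_moment_bounds) auto
  ultimately have "\<forall>\<^sub>F n in sequentially. ereal (a n) * ext_log (prob {\<omega> \<in> space M. Z n \<omega> \<in> C})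
      \<le> ereal (s * t\<^sup>2 / 2 - t * b) + ereal e"
    using eventually_ge_at_top[of 1]
  proof eventually_elim
    case (elim n)
    have a: "0 < a n" using elim a_pos by simp
    note [measurable] = Z_meas[OF elim(4)]
    let ?p = "\<lambda>A. prob {\<omega> \<in> space M. Z n \<omega> \<in> A}"
    let ?u = "exp ((s * t\<^sup>2 / 2 + e/2 - t * b) / a n)"
    have "?p (C \<inter> {0..}) \<le> exp (- (t * b / a n)) * expectation (\<lambda>x. exp (t / a n * Z n x))"
    proof (rule prob_le_exp_moment)
      fix x assume "x \<in> {\<omega> \<in> space M. Z n \<omega> \<in> C \<inter> {0..}}"
      then have "b \<le> Z n x" using b[of "Z n x"] by auto
      then show "t * b / a n \<le> t / a n * Z n x"
        using t a by (simp add: mult_left_mono divide_right_mono)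
    qed (use elim in auto)
    also have "\<dots> \<le> exp (- (t * b / a n)) * exp ((s * t\<^sup>2 / 2 + e/2) / a n)"
      using elim by (intro mult_left_mono) auto
    also have "\<dots> = ?u" by (simp add: mult_exp_exp diff_divide_distrib add_divide_distrib)
    finally have 1: "?p (C \<inter> {0..}) \<le> ?u" .
    have "?p (C \<inter> {..<0}) \<le> exp (- (t * b / a n)) * expectation (\<lambda>x. exp (-t / a n * Z n x))"
    proof (rule prob_le_exp_moment)
      fix x assume "x \<in> {\<omega> \<in> space M. Z n \<omega> \<in> C \<inter> {..<0}}"
      then have "b \<le> - Z n x" using b[of "Z n x"] by auto
      then have "t * b \<le> t * (- Z n x)"
        using t by (rule mult_left_mono)
      then have "t * b / a n \<le> t * (- Z n x) / a n"
        using a by (intro divide_right_mono) auto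
      then show "t * b / a n \<le> - t / a n * Z n x" by simp
    qed (use elim in auto)
    also have "\<dots> \<le> exp (- (t * b / a n)) * exp ((s * t\<^sup>2 / 2 + e/2) / a n)"
      using elim by (intro mult_left_mono) auto
    also have "\<dots> = ?u" by (simp add: mult_exp_exp diff_divide_distrib add_divide_distrib)
    finally have 2: "?p (C \<inter> {..<0}) \<le> ?u" .
    have "?p C \<le> ?p (C \<inter> {0..}) + ?p (C \<inter> {..<0})"
      by (rule order_trans[OF _ measure_Un_le]) (auto intro!: finite_measure_mono)
    with 1 2 have p: "?p C \<le> 2 * ?u" by simp
    show ?case
    proof (cases "?p C = 0")
      case True
      then show ?thesis using a by (simp add: ext_log_def)
    next
      case False
      then have pos: "0 < ?p C" by (simp add: measure_nonneg less_le)
      then have "ln (?p C) \<le> ln (2 * ?u)" using p by (subst ln_le_cancel_iff) auto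
      also have "\<dots> = ln 2 + (s * t\<^sup>2 / 2 + e/2 - t * b) / a n"
        by (subst ln_mult) auto
      finally have "a n * ln (?p C) \<le> a n * (ln 2 + (s * t\<^sup>2 / 2 + e/2 - t * b) / a n)"
        using a by (intro mult_left_mono) auto
      also have "\<dots> = a n * ln 2 + (s * t\<^sup>2 / 2 + e/2 - t * b)"
        using a by (simp add: field_simps)
      finally show ?thesis using False elim by (simp add: ext_log_def)
    qed
  qed
  then show "limsup (\<lambda>n. ereal (a n) * ext_log (prob {\<omega> \<in> space M. Z n \<omega> \<in> C}))
      \<le> ereal (s * t\<^sup>2 / 2 - t * b) + ereal e"
    by (rule Limsup_bounded)
qed

text \<open>The ball is centred at \<open>s * t\<close>, the derivative of the limiting cumulant at
  \<open>t\<close>, around which the law tilted by \<open>t / a n\<close> concentrates; what remains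
  is the cost of undoing the tilt on the ball.\<close>

lemma ball_liminf_ge:
  assumes \<delta>: "0 < \<delta>" and U [measurable]: "U \<in> sets borel" and sub: "ball (s * t) \<delta> \<subseteq> U"
  shows "ereal (- (s * t\<^sup>2 / 2 + \<bar>t\<bar> * \<delta>))
    \<le> liminf (\<lambda>n. ereal (a n) * ext_log (prob {\<omega> \<in> space M. Z n \<omega> \<in> U}))"
proof (rule ereal_le_epsilon2)
  fix e :: real assume e: "0 < e"
  \<comment> \<open>This choice gives \<open>s * r \<le> \<delta>\<close>, so the quadratic cost of
    the extra tilt uses at most half of its gain \<open>r * \<delta>\<close>; the \<open>+ 1\<close>
    accommodates \<open>s = 0\<close>.\<close>
  define r where "r = \<delta> / (s + 1)"
  have r: "0 < r" using \<delta> s_nonneg by (simp add: r_def)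
  have sr: "s * r\<^sup>2 / 2 \<le> r * \<delta> / 2"
  proof -
    have "s * r \<le> \<delta>" using \<delta> s_nonneg by (simp add: r_def field_simps)
    then have "r * (s * r) \<le> r * \<delta>" using r by (intro mult_left_mono) auto
    then show ?thesis by (simp add: power2_eq_square mult_ac)
  qed
  \<comment> \<open>With \<open>4 * \<eta> \<le> r * \<delta> / 2\<close>, the exponents of both
    tails stay below the central one by \<open>2 * \<eta>\<close> even after the errors of the
    moment bounds.\<close>
  define \<eta> where "\<eta> = min (e / 2) (r * \<delta> / 8)"
  have \<eta>: "0 < \<eta>" "\<eta> \<le> e / 2" "\<eta> \<le> r * \<delta> / 8"
    using e r \<delta> by (auto simp: \<eta>_def)
  \<comment> \<open>The margin \<open>2 * \<eta>\<close> then makes each tail at most a quarter of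
    the lower bound for the tilted mass; keeping the remaining half costs the \<open>ln 2\<close>
    treated next.\<close>
  have "(\<lambda>n. a n * ln 4) \<longlonglongrightarrow> 0"
    using tendsto_mult_right[OF a_lim, of "ln 4"] by (simp add: mult.commute)
  then have "\<forall>\<^sub>F n in sequentially. a n * ln 4 < 2 * \<eta>"
    by (rule order_tendstoD(2)) (use \<eta> in auto)
  note a_ln4 = this
  have "(\<lambda>n. a n * ln 2) \<longlonglongrightarrow> 0"
    using tendsto_mult_right[OF a_lim, of "ln 2"] by (simp add: mult.commute)
  then have "\<forall>\<^sub>F n in sequentially. a n * ln 2 < e / 2"
    by (rule order_tendstoD(2)) (use e in auto)
  with a_ln4 eventually_moment_bounds[OF \<eta>(1), of t] eventually_moment_bounds[OF \<eta>(1), of "t + r"]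
    eventually_moment_bounds[OF \<eta>(1), of "t - r"] eventually_ge_at_top[of 1]
  have "\<forall>\<^sub>F n in sequentially. ereal (- (s * t\<^sup>2 / 2 + \<bar>t\<bar> * \<delta>) - e)
      \<le> ereal (a n) * ext_log (prob {\<omega> \<in> space M. Z n \<omega> \<in> U})"
  proof eventually_elim
    case (elim n)
    have a: "0 < a n" using elim a_pos by simp
    note [measurable] = Z_meas[OF elim(5)]
    let ?E = "\<lambda>t. expectation (\<lambda>x. exp (t / a n * Z n x))"
    let ?y = "s * t"
    let ?p = "prob {\<omega> \<in> space M. Z n \<omega> \<in> U}"
    let ?u = "s * t\<^sup>2 / 2 - \<eta>"
    have c1: "exp (- (r / a n) * (?y + \<delta>)) * ?E (t + r) \<le> exp ((?u - 2 * \<eta>) / a n)"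
    proof -
      have "exp (- (r / a n) * (?y + \<delta>)) * ?E (t + r)
          \<le> exp (- (r / a n) * (?y + \<delta>)) * exp ((s * (t + r)\<^sup>2 / 2 + \<eta>) / a n)"
        using elim by (intro mult_left_mono) auto
      also have "\<dots> = exp ((- r * (?y + \<delta>) + (s * (t + r)\<^sup>2 / 2 + \<eta>)) / a n)"
        by (simp only: mult_exp_exp add_divide_distrib) simp
      also have "\<dots> \<le> exp ((?u - 2 * \<eta>) / a n)"
      proof -
        \<comment> \<open>The cross term \<open>s * t * r\<close> of the square cancels against
          \<open>r * ?y\<close>, because the ball is centred at \<open>s * t\<close>.\<close>
        have "- r * (?y + \<delta>) + (s * (t + r)\<^sup>2 / 2 + \<eta>) = s * t\<^sup>2 / 2 + s * r\<^sup>2 / 2 - r * \<delta> + \<eta>"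
          by (simp add: power2_eq_square field_simps)
        also have "\<dots> \<le> ?u - 2 * \<eta>" using sr \<eta> by linarith
        finally show ?thesis using a by (simp add: divide_right_mono)
      qed
      finally show ?thesis .
    qed
    have c2: "exp (r / a n * (?y - \<delta>)) * ?E (t - r) \<le> exp ((?u - 2 * \<eta>) / a n)"
    proof -
      have "exp (r / a n * (?y - \<delta>)) * ?E (t - r)
          \<le> exp (r / a n * (?y - \<delta>)) * exp ((s * (t - r)\<^sup>2 / 2 + \<eta>) / a n)"
        using elim by (intro mult_left_mono) auto
      also have "\<dots> = exp ((r * (?y - \<delta>) + (s * (t - r)\<^sup>2 / 2 + \<eta>)) / a n)"
        by (simp only: mult_exp_exp add_divide_distrib) simp
      also have "\<dots> \<le> exp ((?u - 2 * \<eta>) / a n)"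
      proof -
        have "r * (?y - \<delta>) + (s * (t - r)\<^sup>2 / 2 + \<eta>) = s * t\<^sup>2 / 2 + s * r\<^sup>2 / 2 - r * \<delta> + \<eta>"
          by (simp add: power2_eq_square field_simps)
        also have "\<dots> \<le> ?u - 2 * \<eta>" using sr \<eta> by linarith
        finally show ?thesis using a by (simp add: divide_right_mono)
      qed
      finally show ?thesis .
    qed
    have c3: "exp ((?u - 2 * \<eta>) / a n) \<le> exp (?u / a n) / 4"
    proof -
      have "ln 4 \<le> 2 * \<eta> / a n" using elim a by (simp add: field_simps)
      then have "exp (ln 4) \<le> exp (2 * \<eta> / a n)" by (simp only: exp_le_cancel_iff)
      then have "exp ((?u - 2 * \<eta>) / a n) * 4 \<le> exp ((?u - 2 * \<eta>) / a n) * exp (2 * \<eta> / a n)"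
        by (intro mult_left_mono) auto
      also have "\<dots> = exp (?u / a n)"
        by (simp only: mult_exp_exp add_divide_distrib[symmetric]) simp
      finally show ?thesis by linarith
    qed
    have "exp (?u / a n) / 2 \<le> ?E t - exp (- (r / a n) * (?y + \<delta>)) * ?E (t + r)
        - exp (r / a n * (?y - \<delta>)) * ?E (t - r)"
      using c1 c2 c3 elim by linarith
    then have "exp (- (t / a n * ?y + \<bar>t / a n\<bar> * \<delta>)) * (exp (?u / a n) / 2) \<le>
        exp (- (t / a n * ?y + \<bar>t / a n\<bar> * \<delta>)) * (?E t - exp (- (r / a n) * (?y + \<delta>)) * ?E (t + r)
        - exp (r / a n * (?y - \<delta>)) * ?E (t - r))"
      by (intro mult_left_mono) auto
    also have "\<dots> \<le> prob {x\<in>space M. Z n x \<in> ball ?y \<delta>}"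
    proof -
      have e: "t / a n + r / a n = (t + r) / a n" "t / a n - r / a n = (t - r) / a n"
        by (simp_all add: add_divide_distrib diff_divide_distrib)
      show ?thesis
        using elim r a
        by (intro tilted_tail_le[of "Z n" "t / a n" "r / a n" ?y \<delta>, unfolded e]) (simp_all only: Z_meas divide_nonneg_pos less_imp_le)
    qed
    also have "\<dots> \<le> ?p"
      using sub by (intro finite_measure_mono) auto
    finally have p: "exp (- (t / a n * ?y + \<bar>t / a n\<bar> * \<delta>)) * (exp (?u / a n) / 2) \<le> ?p" .
    have p0: "0 < ?p" by (rule less_le_trans[OF _ p]) simp
    have "exp (- (t / a n * ?y + \<bar>t / a n\<bar> * \<delta>) + ?u / a n - ln 2) \<le> ?p"
      using p by (simp only: exp_diff exp_add) simp
    then have "- (t / a n * ?y + \<bar>t / a n\<bar> * \<delta>) + ?u / a n - ln 2 \<le> ln ?p"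
      by (simp only: ln_ge_iff[OF p0])
    then have "a n * (- (t / a n * ?y + \<bar>t / a n\<bar> * \<delta>) + ?u / a n - ln 2) \<le> a n * ln ?p"
      using a by (intro mult_left_mono) auto
    moreover have "a n * (- (t / a n * ?y + \<bar>t / a n\<bar> * \<delta>) + ?u / a n - ln 2) =
        - (s * t\<^sup>2 / 2 + \<bar>t\<bar> * \<delta>) - \<eta> - a n * ln 2"
    proof -
      have "a n * (- (p + q) + u - ln 2) = - (a n * p + a n * q) + a n * u - a n * ln 2" for p q u
        by (simp add: algebra_simps)
      moreover have "a n * (t / a n * ?y) = s * t\<^sup>2" "a n * (\<bar>t / a n\<bar> * \<delta>) = \<bar>t\<bar> * \<delta>"
        "a n * (?u / a n) = ?u"
        using a by (simp_all add: abs_divide power2_eq_square)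
      ultimately show ?thesis by simp
    qed
    ultimately have "- (s * t\<^sup>2 / 2 + \<bar>t\<bar> * \<delta>) - e \<le> a n * ln ?p" using elim \<eta> by linarith
    then show ?case using p0 by (simp add: ext_log_def)
  qed
  then have "ereal (- (s * t\<^sup>2 / 2 + \<bar>t\<bar> * \<delta>) - e)
      \<le> liminf (\<lambda>n. ereal (a n) * ext_log (prob {\<omega> \<in> space M. Z n \<omega> \<in> U}))"
    by (rule Liminf_bounded)
  then have "ereal (- (s * t\<^sup>2 / 2 + \<bar>t\<bar> * \<delta>) - e) + ereal e
      \<le> liminf (\<lambda>n. ereal (a n) * ext_log (prob {\<omega> \<in> space M. Z n \<omega> \<in> U})) + ereal e"
    by (rule add_right_mono)
  moreover have "ereal (- (s * t\<^sup>2 / 2 + \<bar>t\<bar> * \<delta>) - e) + ereal e = ereal (- (s * t\<^sup>2 / 2 + \<bar>t\<bar> * \<delta>))"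
    by simp
  ultimately show "ereal (- (s * t\<^sup>2 / 2 + \<bar>t\<bar> * \<delta>))
      \<le> liminf (\<lambda>n. ereal (a n) * ext_log (prob {\<omega> \<in> space M. Z n \<omega> \<in> U})) + ereal e"
    by (simp only:)
qed

text \<open>The rate grows with the distance from 0, so a point of \<open>C\<close> nearest to 0
  controls the whole set: a single two-sided tail bound replaces a covering argument.\<close>

lemma closed_limsup_le:
  assumes C: "closed C"
  shows "limsup (\<lambda>n. ereal (a n) * ext_log (prob {\<omega> \<in> space M. Z n \<omega> \<in> C})) \<le> - (INF x\<in>C. gauss_rate s x)"
proof (cases "C = {}")
  case True
  have "\<forall>\<^sub>F n in sequentially. ereal (a n) * ext_log (prob {\<omega> \<in> space M. Z n \<omega> \<in> C}) \<le> - \<infinity>"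
    using eventually_a_pos by eventually_elim (use True in \<open>simp add: ext_log_def\<close>)
  then have "limsup (\<lambda>n. ereal (a n) * ext_log (prob {\<omega> \<in> space M. Z n \<omega> \<in> C})) \<le> - \<infinity>"
    by (rule Limsup_bounded)
  then show ?thesis using True by (simp add: top_ereal_def)
next
  case False
  let ?l = "limsup (\<lambda>n. ereal (a n) * ext_log (prob {\<omega> \<in> space M. Z n \<omega> \<in> C}))"
  obtain x where x: "x \<in> C" and "\<And>y. y \<in> C \<Longrightarrow> dist 0 x \<le> dist 0 y"
    using distance_attains_inf[OF C False, of 0] by blast
  then have le: "\<And>y. y \<in> C \<Longrightarrow> \<bar>x\<bar> \<le> \<bar>y\<bar>" by (simp add: dist_real_def)
  have bd: "?l \<le> ereal (s * t\<^sup>2 / 2 - t * \<bar>x\<bar>)" if "0 \<le> t" for t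
    using C le that by (intro tail_limsup_le) (auto intro: borel_closed)
  have "?l \<le> - gauss_rate s x"
  proof (cases "s = 0")
    case True
    show ?thesis
    proof (cases "x = 0")
      case True
      then show ?thesis using bd[of 0] \<open>s = 0\<close> by (simp add: gauss_rate_def zero_ereal_def)
    next
      case False
      \<comment> \<open>Without quadratic cost the bound \<open>- t * \<bar>x\<bar>\<close> becomes
        arbitrarily negative as \<open>t\<close> grows.\<close>
      have "?l \<le> ereal B" for B
      proof -
        have "?l \<le> ereal (- (\<bar>B\<bar> / \<bar>x\<bar>) * \<bar>x\<bar>)"
          using bd[of "\<bar>B\<bar> / \<bar>x\<bar>"] \<open>s = 0\<close> by simp
        also have "\<dots> \<le> ereal B" using False by simp
        finally show ?thesis .
      qed
      then have "?l = - \<infinity>" by (rule ereal_bot)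
      then show ?thesis by simp
    qed
  next
    case False
    then have s: "0 < s" using s_nonneg by simp
    \<comment> \<open>The value \<open>\<bar>x\<bar> / s\<close> minimises the parabola in
      \<open>t\<close> given by \<open>bd\<close>.\<close>
    have "s * (\<bar>x\<bar> / s)\<^sup>2 / 2 - \<bar>x\<bar> / s * \<bar>x\<bar> = - (x\<^sup>2 / (2 * s))"
      using s by (simp add: power2_eq_square field_simps)
    with bd[of "\<bar>x\<bar> / s"] s show ?thesis by (simp add: gauss_rate_def)
  qed
  also have "\<dots> \<le> - (INF x\<in>C. gauss_rate s x)"
    using x by (simp add: INF_lower)
  finally show ?thesis .
qed

lemma open_liminf_ge:
  assumes U: "open U"
  shows "- (INF x\<in>U. gauss_rate s x) \<le> liminf (\<lambda>n. ereal (a n) * ext_log (prob {\<omega> \<in> space M. Z n \<omega> \<in> U}))"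
proof -
  let ?l = "liminf (\<lambda>n. ereal (a n) * ext_log (prob {\<omega> \<in> space M. Z n \<omega> \<in> U}))"
  have "- gauss_rate s y \<le> ?l" if y: "y \<in> U" for y
  proof (cases "s = 0 \<and> y \<noteq> 0")
    case True
    then show ?thesis by (simp add: gauss_rate_def)
  next
    case False
    define t where "t = (if s = 0 then 0 else y / s)"
    have t: "y = s * t" and rate: "gauss_rate s y = ereal (s * t\<^sup>2 / 2)"
      using False by (auto simp: t_def gauss_rate_def zero_ereal_def power2_eq_square)
    obtain d where d: "0 < d" "ball y d \<subseteq> U"
      using U y by (meson open_contains_ball)
    have "ereal (- (s * t\<^sup>2 / 2)) \<le> ?l"
    proof (rule ereal_le_epsilon2)
      fix e :: real assume e: "0 < e"
      \<comment> \<open>Small enough that undoing the tilt over the ball costs at most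
        \<open>e\<close>.\<close>
      define \<delta> where "\<delta> = min d (e / (\<bar>t\<bar> + 1))"
      have \<delta>: "0 < \<delta>" "\<delta> \<le> d" "\<delta> \<le> e / (\<bar>t\<bar> + 1)" using d e by (auto simp: \<delta>_def)
      have "\<bar>t\<bar> * \<delta> \<le> (\<bar>t\<bar> + 1) * (e / (\<bar>t\<bar> + 1))"
        using \<delta> by (intro mult_mono) auto
      also have "\<dots> = e" by simp
      finally have te: "\<bar>t\<bar> * \<delta> \<le> e" .
      have "ball (s * t) \<delta> \<subseteq> U" using d \<delta> subset_ball[of \<delta> d y] unfolding t by blast
      then have "ereal (- (s * t\<^sup>2 / 2 + \<bar>t\<bar> * \<delta>)) \<le> ?l"
        using \<delta> U by (intro ball_liminf_ge) auto
      then have "ereal (- (s * t\<^sup>2 / 2 + \<bar>t\<bar> * \<delta>)) + ereal e \<le> ?l + ereal e"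
        by (rule add_right_mono)
      moreover have "ereal (- (s * t\<^sup>2 / 2)) \<le> ereal (- (s * t\<^sup>2 / 2 + \<bar>t\<bar> * \<delta>)) + ereal e"
        using te by simp
      ultimately show "ereal (- (s * t\<^sup>2 / 2)) \<le> ?l + ereal e" by (rule order_trans[rotated])
    qed
    then show ?thesis by (simp add: rate)
  qed
  then show ?thesis
    unfolding ereal_INF_uminus_eq[symmetric] by (metis (mono_tags, lifting) SUP_least ereal_SUP_uminus_eq)
qed

theorem satisfies_LDP_gauss: "satisfies_LDP M Z (\<lambda>n. 1 / a n) (gauss_rate s)"
proof -
  have "filterlim a (at_right 0) sequentially"
    unfolding filterlim_at using a_lim eventually_a_pos by (auto elim: eventually_mono)
  then have "filterlim (\<lambda>n. inverse (a n)) at_top sequentially"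
    by (rule filterlim_compose[OF filterlim_inverse_at_top_right])
  then show ?thesis
    unfolding satisfies_LDP_def
    using Z_meas s_nonneg closed_limsup_le open_liminf_ge
    by (auto simp: gauss_rate_nonneg lower_semicont_gauss inverse_eq_divide)
qed

end

section \<open>Cumulants of the statistic\<close>

lemma C_stat_eq_spacing_sum:
  "C_stat w X n \<omega> = spacing_sum (\<lambda>k. w (real k / real n)) 0 (sorted_vals {1..n} (\<lambda>i. X i \<omega>))"
proof -
  have "sort (map (\<lambda>i. X i \<omega>) [1..<Suc n]) = sorted_vals {1..n} (\<lambda>i. X i \<omega>)"
    unfolding sorted_vals_def sorted_list_of_multiset_mset[symmetric] mset_map mset_upt
    by (simp add: atLeastLessThanSuc_atLeastAtMost)
  \<comment> \<open>Order statistics count from 1 and lists from 0; the prepended 0 stands for the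
    zeroth order statistic.\<close>
  then have "order_stat X n (k + 1) \<omega> - order_stat X n k \<omega> =
      sorted_vals {1..n} (\<lambda>i. X i \<omega>) ! k - (0 # sorted_vals {1..n} (\<lambda>i. X i \<omega>)) ! k" for k
    unfolding order_stat_def by (cases k) simp_all
  then show ?thesis
    by (simp add: C_stat_def spacing_sum_eq_sum)
qed

lemma spacing_sum_scale: "t * spacing_sum c p xs = spacing_sum (\<lambda>k. t * c k) p xs"
  by (simp add: spacing_sum_eq_sum sum_distrib_left mult.assoc)

text \<open>The normalised spacing, \<open>n - k\<close> times the \<open>k\<close>-th spacing,
  enters the statistic with coefficient \<open>w (k / n) / (n - k)\<close>, which is
  \<open>h_fun w (k / n) / n\<close>.\<close>

lemma h_fun_grid:
  assumes "k < n"
  shows "real (n - k) * h_fun w (real k / real n) = real n * w (real k / real n)"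
  using assms by (simp add: h_fun_def of_nat_diff field_simps)

locale exponential_sample = prob_space M for M :: "'a measure" +
  fixes X :: "nat \<Rightarrow> 'a \<Rightarrow> real" and lam :: real
  assumes lam_pos: "0 < lam"
    and indep: "indep_vars (\<lambda>_. borel) X {1..}"
    and distr_X: "\<And>n. 1 \<le> n \<Longrightarrow> distributed M lborel (X n) (\<lambda>t. ennreal (exponential_density lam t))"
begin

lemma X_measurable: "1 \<le> i \<Longrightarrow> X i \<in> borel_measurable M"
  using distributed_measurable[OF distr_X, of i] by simp

lemma sample_measurable: "(\<lambda>\<omega>. \<lambda>i\<in>{1..n}. X i \<omega>) \<in> measurable M (PiM {1..n} (\<lambda>_. borel))"
  by (rule measurable_restrict) (simp add: X_measurable)

lemma distr_sample:
  assumes "1 \<le> n"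
  shows "distr M (PiM {1..n} (\<lambda>_. borel)) (\<lambda>\<omega>. \<lambda>i\<in>{1..n}. X i \<omega>) = PiM {1..n} (\<lambda>_. exp_law lam)"
proof -
  have "indep_vars (\<lambda>_. borel) X {1..n}"
    by (rule indep_vars_subset[OF indep]) auto
  then have "distr M (PiM {1..n} (\<lambda>_. borel)) (\<lambda>\<omega>. \<lambda>i\<in>{1..n}. X i \<omega>) = PiM {1..n} (\<lambda>i. distr M borel (X i))"
    using assms by (subst (asm) indep_vars_iff_distr_eq_PiM') (auto simp: X_measurable)
  also have "\<dots> = PiM {1..n} (\<lambda>_. exp_law lam)"
  proof (rule PiM_cong)
    fix i assume "i \<in> {1..n}"
    then have "distr M lborel (X i) = exp_law lam"
      unfolding exp_law_def by (intro distributed_distr_eq_density distr_X) simp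
    then show "distr M borel (X i) = exp_law lam"
      by (metis distr_cong sets_lborel)
  qed simp
  finally show ?thesis .
qed

lemma C_stat_eq_sample:
  "C_stat w X n \<omega> = spacing_sum (\<lambda>k. w (real k / real n)) 0 (sorted_vals {1..n} (\<lambda>i\<in>{1..n}. X i \<omega>))"
  unfolding C_stat_eq_spacing_sum
  by (intro arg_cong[where f = "spacing_sum _ _"] sorted_vals_cong) simp

lemma C_stat_measurable: "C_stat w X n \<in> borel_measurable M"
  using measurable_compose[OF sample_measurable spacing_sum_measurable]
  unfolding C_stat_eq_sample[abs_def] by simp

text \<open>Finiteness of the nonnegative integral yields integrability together with the value. The
  product is written as the exponential of a sum of logarithms because both the mean and the
  limiting cumulant are read off the exponent.\<close>

lemma C_stat_mgf:
  assumes n: "1 \<le> n" and t: "\<And>k. k < n \<Longrightarrow> t * h_fun w (real k / real n) < real n * lam"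
  shows "has_bochner_integral M (\<lambda>\<omega>. exp (t * C_stat w X n \<omega>))
    (exp (\<Sum>k<n. - ln (1 - t * h_fun w (real k / real n) / (real n * lam))))"
proof (rule has_bochner_integral_nn_integral)
  let ?w = "\<lambda>k. w (real k / real n)"
  let ?h = "\<lambda>k. h_fun w (real k / real n)"
  show "(\<lambda>\<omega>. exp (t * C_stat w X n \<omega>)) \<in> borel_measurable M"
    using C_stat_measurable[of w n] by measurable
  \<comment> \<open>This turns each condition \<open>t * ?w k < real (n - k) * lam\<close> into the
    hypothesis on \<open>t\<close>.\<close>
  have tw: "t * ?w k = real (n - k) * (t * ?h k / real n)" if "k < n" for k
    using h_fun_grid[OF that, of w] n by (simp add: field_simps)
  have "(\<integral>\<^sup>+ \<omega>. ennreal (exp (t * C_stat w X n \<omega>)) \<partial>M)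
      = (\<integral>\<^sup>+ \<omega>. ennreal (exp (spacing_sum (\<lambda>k. t * ?w k) 0 (sorted_vals {1..n} (\<lambda>i\<in>{1..n}. X i \<omega>)))) \<partial>M)"
    unfolding C_stat_eq_sample spacing_sum_scale ..
  also have "\<dots> = (\<integral>\<^sup>+ x. ennreal (exp (spacing_sum (\<lambda>k. t * ?w k) 0 (sorted_vals {1..n} x)))
      \<partial>distr M (PiM {1..n} (\<lambda>_. borel)) (\<lambda>\<omega>. \<lambda>i\<in>{1..n}. X i \<omega>))"
    using spacing_sum_measurable[OF finite_atLeastAtMost[of 1 n], of "\<lambda>k. t * ?w k" 0]
    by (intro nn_integral_distr[OF sample_measurable, symmetric]) measurable
  also have "\<dots> = ennreal (\<Prod>k<n. real (n - k) * lam / (real (n - k) * lam - t * ?w k))"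
    unfolding distr_sample[OF n]
  proof (rule nn_integral_exp_spacing_sum[OF lam_pos])
    fix k assume k: "k < n"
    have "t * ?h k / real n < lam" using t[OF k] n by (simp add: field_simps)
    then show "t * ?w k < real (n - k) * lam"
      unfolding tw[OF k] using k by (intro mult_strict_left_mono) auto
  qed simp_all
  also have "(\<Prod>k<n. real (n - k) * lam / (real (n - k) * lam - t * ?w k))
      = (\<Prod>k<n. exp (- ln (1 - t * ?h k / (real n * lam))))"
  proof (rule prod.cong)
    fix k assume "k \<in> {..<n}"
    then have k: "k < n" by simp
    have "t * ?h k / (real n * lam) < 1" using t[OF k] n lam_pos by (simp add: field_simps)
    then have "exp (- ln (1 - t * ?h k / (real n * lam))) = 1 / (1 - t * ?h k / (real n * lam))"
      by (simp add: exp_minus inverse_eq_divide)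
    also have "\<dots> = (real (n - k) * lam) * 1 / ((real (n - k) * lam) * (1 - t * ?h k / (real n * lam)))"
      using k lam_pos by (subst mult_divide_mult_cancel_left) auto
    also have "(real (n - k) * lam) * (1 - t * ?h k / (real n * lam)) = real (n - k) * lam - t * ?w k"
      unfolding tw[OF k] using lam_pos by (simp add: right_diff_distrib)
    finally show "real (n - k) * lam / (real (n - k) * lam - t * ?w k) = exp (- ln (1 - t * ?h k / (real n * lam)))"
      by simp
  qed simp
  also have "\<dots> = exp (\<Sum>k<n. - ln (1 - t * ?h k / (real n * lam)))"
    by (simp only: exp_sum finite_lessThan)
  finally show "(\<integral>\<^sup>+ \<omega>. ennreal (exp (t * C_stat w X n \<omega>)) \<partial>M) =
      ennreal (exp (\<Sum>k<n. - ln (1 - t * ?h k / (real n * lam))))" .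
qed auto

end

text \<open>
  Since \<open>1 + t * E Z \<le> G t\<close> with equality at \<open>t = 0\<close>, the line is tangent to \<open>G\<close> there.
\<close>

lemma (in prob_space) expectation_eq_deriv_mgf:
  assumes Z [measurable]: "Z \<in> borel_measurable M" and d: "0 < d"
    and mgf: "\<And>t. \<bar>t\<bar> < d \<Longrightarrow> has_bochner_integral M (\<lambda>\<omega>. exp (t * Z \<omega>)) (G t)"
    and deriv: "(G has_real_derivative m) (at 0)"
  shows "expectation Z = m"
proof -
  have int: "integrable M (\<lambda>\<omega>. exp (t * Z \<omega>))" and E: "expectation (\<lambda>\<omega>. exp (t * Z \<omega>)) = G t"
    if "\<bar>t\<bar> < d" for t
    using mgf[OF that] by (auto simp: has_bochner_integral_iff)
  have "integrable M Z"
  proof (rule Bochner_Integration.integrable_bound)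
    \<comment> \<open>Exponential moments on both sides of 0 dominate
      \<open>\<bar>Z \<omega>\<bar>\<close>, by \<open>x \<le> exp x\<close> at
      \<open>\<plusminus> d / 2 * Z \<omega>\<close>.\<close>
    show "integrable M (\<lambda>\<omega>. (exp (d / 2 * Z \<omega>) + exp (- (d / 2) * Z \<omega>)) / (d / 2))"
      using int[of "d / 2"] int[of "- (d / 2)"] d by (intro integrable_divide Bochner_Integration.integrable_add) auto
    show "AE \<omega> in M. norm (Z \<omega>) \<le> norm ((exp (d / 2 * Z \<omega>) + exp (- (d / 2) * Z \<omega>)) / (d / 2))"
    proof (rule AE_I2)
      fix \<omega>
      have "d / 2 * Z \<omega> \<le> exp (d / 2 * Z \<omega>)" "- (d / 2) * Z \<omega> \<le> exp (- (d / 2) * Z \<omega>)"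
        using exp_ge_add_one_self[of "d / 2 * Z \<omega>"] exp_ge_add_one_self[of "- (d / 2) * Z \<omega>"] by linarith+
      then have "d / 2 * \<bar>Z \<omega>\<bar> \<le> exp (d / 2 * Z \<omega>) + exp (- (d / 2) * Z \<omega>)"
      proof -
        have "d / 2 * \<bar>Z \<omega>\<bar> = d / 2 * Z \<omega> \<or> d / 2 * \<bar>Z \<omega>\<bar> = - (d / 2) * Z \<omega>"
          by (cases "0 \<le> Z \<omega>") auto
        moreover have "0 < exp (d / 2 * Z \<omega>)" "0 < exp (- (d / 2) * Z \<omega>)"
          by (rule exp_gt_zero)+
        ultimately show ?thesis
          using \<open>d / 2 * Z \<omega> \<le> exp (d / 2 * Z \<omega>)\<close> \<open>- (d / 2) * Z \<omega> \<le> exp (- (d / 2) * Z \<omega>)\<close> by linarith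
      qed
      then show "norm (Z \<omega>) \<le> norm ((exp (d / 2 * Z \<omega>) + exp (- (d / 2) * Z \<omega>)) / (d / 2))"
        using d by (simp add: field_simps)
    qed
  qed measurable
  have "G t \<ge> 1 + t * expectation Z" if t: "\<bar>t\<bar> < d" for t
  proof -
    have "1 + t * expectation Z = expectation (\<lambda>\<omega>. 1 + t * Z \<omega>)"
      using \<open>integrable M Z\<close> by (simp add: prob_space)
    also have "\<dots> \<le> expectation (\<lambda>\<omega>. exp (t * Z \<omega>))"
      using \<open>integrable M Z\<close> int[OF t] by (intro integral_mono) auto
    finally show ?thesis using E[OF t] by simp
  qed
  moreover have "G 0 = 1"
    using E[of 0] d by (simp add: prob_space)
  ultimately have "\<forall>t. \<bar>0 - t\<bar> < d \<longrightarrow> G 0 - 0 * expectation Z \<le> G t - t * expectation Z"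
    by (auto simp: algebra_simps)
  moreover have "((\<lambda>t. G t - t * expectation Z) has_real_derivative m - expectation Z) (at 0)"
    using deriv by (auto intro!: derivative_eq_intros)
  ultimately have "m - expectation Z = 0"
    by (intro DERIV_local_min[of "\<lambda>t. G t - t * expectation Z" _ 0 d]) (use d in auto)
  then show ?thesis by simp
qed

lemma (in exponential_sample) expectation_C_stat:
  assumes n: "1 \<le> n"
  shows "expectation (C_stat w X n) = (\<Sum>k<n. h_fun w (real k / real n) / (real n * lam))"
proof -
  let ?h = "\<lambda>k. h_fun w (real k / real n)"
  \<comment> \<open>A crude bound on the finitely many grid values, enough for a neighbourhood of 0
    in which the generating function is finite; the 1 keeps it positive.\<close>
  define B where "B = 1 + (\<Sum>k<n. \<bar>?h k\<bar>)"
  have B: "1 \<le> B" by (simp add: B_def sum_nonneg)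
  have hB: "\<bar>?h k\<bar> \<le> B" if "k < n" for k
    using member_le_sum[of k "{..<n}" "\<lambda>k. \<bar>?h k\<bar>"] that by (simp add: B_def)
  show ?thesis
  proof (rule expectation_eq_deriv_mgf[OF C_stat_measurable])
    show "0 < real n * lam / B" using n lam_pos B by simp
  next
    fix t :: real assume t: "\<bar>t\<bar> < real n * lam / B"
    have "t * ?h k < real n * lam" if "k < n" for k
    proof -
      have "t * ?h k \<le> \<bar>t\<bar> * \<bar>?h k\<bar>" by (metis abs_ge_self abs_mult)
      also have "\<dots> \<le> \<bar>t\<bar> * B" using hB[OF that] by (intro mult_left_mono) auto
      also have "\<dots> < real n * lam" using t B by (simp add: field_simps)
      finally show ?thesis .
    qed
    then show "has_bochner_integral M (\<lambda>\<omega>. exp (t * C_stat w X n \<omega>))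
      (exp (\<Sum>k<n. - ln (1 - t * ?h k / (real n * lam))))"
      by (intro C_stat_mgf n)
  next
    show "((\<lambda>t. exp (\<Sum>k<n. - ln (1 - t * ?h k / (real n * lam)))) has_real_derivative
      (\<Sum>k<n. ?h k / (real n * lam))) (at 0)"
    proof -
      have "((\<lambda>t. - ln (1 - t * q)) has_real_derivative q) (at 0)" for q
        by (auto intro!: derivative_eq_intros)
      then have "((\<lambda>t. \<Sum>k<n. - ln (1 - t * (?h k / (real n * lam)))) has_real_derivative
          (\<Sum>k<n. ?h k / (real n * lam))) (at 0)"
        by (intro DERIV_sum)
      then show ?thesis by (auto dest: DERIV_fun_exp)
    qed
  qed
qed

section \<open>Riemann sums and the expansion of the logarithm\<close>

text \<open>The function \<open>h_fun w\<close> may oscillate at 1 without a limit, so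
  \<open>g\<close> is only continuous and bounded on the half-open interval. Dominated convergence
  of step functions handles this.\<close>

lemma riemann_sum_tendsto:
  fixes g :: "real \<Rightarrow> real"
  assumes cont: "continuous_on {0..<1} g" and bound: "\<And>x. x \<in> {0..<1} \<Longrightarrow> \<bar>g x\<bar> \<le> B"
  shows "(\<lambda>n. (\<Sum>k<n. g (real k / real n)) / real n) \<longlonglongrightarrow> (LINT x:{0..<1}|lborel. g x)"
proof -
  \<comment> \<open>Step function with left endpoint values, whose integral is the Riemann sum; left
    endpoints stay below 1, where \<open>g\<close> is controlled.\<close>
  define s where "s n x = (\<Sum>k<n. g (real k / real n) * indicator {real k / real n..<real (k + 1) / real n} x)"
    for n x
  have B: "0 \<le> B" using bound[of 0] by auto
  have s_in: "s n x = g (real (nat \<lfloor>real n * x\<rfloor>) / real n) \<and> nat \<lfloor>real n * x\<rfloor> < n"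
    if n: "1 \<le> n" and x: "x \<in> {0..<1}" for n x
  proof -
    let ?m = "nat \<lfloor>real n * x\<rfloor>"
    have nx: "0 \<le> real n * x" using x by simp
    have "x \<in> {real k / real n..<real (k + 1) / real n} \<longleftrightarrow> real k \<le> real n * x \<and> real n * x < real k + 1" for k
      using n by (auto simp: field_simps)
    also have "\<dots> k \<longleftrightarrow> k = ?m" for k
      using nx by (auto simp: nat_eq_iff2 floor_eq_iff)
    finally have iff: "x \<in> {real k / real n..<real (k + 1) / real n} \<longleftrightarrow> k = ?m" for k .
    have "real n * x < real n" using n x by simp
    then have "?m < n" using nx by linarith
    moreover have "s n x = (\<Sum>k<n. if k = ?m then g (real ?m / real n) else 0)"
      unfolding s_def
    proof (rule sum.cong)
      fix k
      show "g (real k / real n) * indicator {real k / real n..<real (k + 1) / real n} x = (if k = ?m then g (real ?m / real n) else 0)"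
        using iff[of k] by (cases "k = ?m") (simp_all only: indicator_simps if_True if_False mult_1_right mult_zero_right simp_thms)
    qed simp
    ultimately show ?thesis by simp
  qed
  have s_out: "s n x = 0" if x: "x \<notin> {0..<1}" for n x
  proof -
    have "x \<notin> {real k / real n..<real (k + 1) / real n}" if k: "k < n" for k
    proof
      assume "x \<in> {real k / real n..<real (k + 1) / real n}"
      then have "0 \<le> x" "x < real (k + 1) / real n" by (auto intro: order_trans[rotated])
      moreover have "real (k + 1) / real n \<le> 1" using k by (simp add: field_simps)
      ultimately show False using x by auto
    qed
    then show ?thesis unfolding s_def by (intro sum.neutral) (simp del: atLeastLessThan_iff)
  qed
  have int_s: "integral\<^sup>L lborel (s n) = (\<Sum>k<n. g (real k / real n)) / real n" for n
  proof -
    have "integral\<^sup>L lborel (s n) = (\<Sum>k<n. g (real k / real n) * (real (k + 1) / real n - real k / real n))"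
      unfolding s_def
      by (subst Bochner_Integration.integral_sum) (auto simp: divide_right_mono)
    also have "\<dots> = (\<Sum>k<n. g (real k / real n)) / real n"
      by (simp add: sum_divide_distrib diff_divide_distrib[symmetric])
    finally show ?thesis .
  qed
  have "(\<lambda>n. integral\<^sup>L lborel (s n)) \<longlonglongrightarrow> (\<integral>x. indicator {0..<1} x *\<^sub>R g x \<partial>lborel)"
  proof (rule integral_dominated_convergence)
    show "(\<lambda>x. indicator {0..<1} x *\<^sub>R g x) \<in> borel_measurable lborel"
      using borel_measurable_continuous_on_indicator[OF _ cont] by simp
    show "s n \<in> borel_measurable lborel" for n
      unfolding s_def by measurable
    show "integrable lborel (\<lambda>x. indicator {0..<1::real} x * B)"
      by simp
    show "AE x in lborel. (\<lambda>n. s n x) \<longlonglongrightarrow> indicator {0..<1} x *\<^sub>R g x"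
    proof (rule AE_I2)
      fix x :: real
      show "(\<lambda>n. s n x) \<longlonglongrightarrow> indicator {0..<1} x *\<^sub>R g x"
      proof (cases "x \<in> {0..<1}")
        case False
        then show ?thesis by (simp add: s_out)
      next
        case True
        let ?q = "\<lambda>n. real (nat \<lfloor>real n * x\<rfloor>) / real n"
        have "?q \<longlonglongrightarrow> x"
        proof (rule tendsto_sandwich)
          show "\<forall>\<^sub>F n in sequentially. x - 1 / real n \<le> ?q n"
            using eventually_ge_at_top[of 1]
          proof eventually_elim
            case (elim n)
            have "real n * x - 1 \<le> real (nat \<lfloor>real n * x\<rfloor>)" by linarith
            then have "(real n * x - 1) / real n \<le> ?q n" by (rule divide_right_mono) simp
            then show ?case using elim by (simp add: diff_divide_distrib)
          qed
          show "\<forall>\<^sub>F n in sequentially. ?q n \<le> x"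
            using eventually_ge_at_top[of 1]
          proof eventually_elim
            case (elim n)
            have "0 \<le> real n * x" using True by simp
            then have "real (nat \<lfloor>real n * x\<rfloor>) \<le> real n * x" by linarith
            then show ?case using elim by (simp add: field_simps)
          qed
          show "(\<lambda>n. x - 1 / real n) \<longlonglongrightarrow> x"
            using tendsto_diff[OF tendsto_const lim_1_over_n, of x] by simp
        qed simp
        then have "(\<lambda>n. g (?q n)) \<longlonglongrightarrow> g x"
        proof (rule continuous_on_tendsto_compose[OF cont _ True])
          show "\<forall>\<^sub>F n in sequentially. ?q n \<in> {0..<1}"
            using eventually_ge_at_top[of 1]
            by eventually_elim (use s_in[OF _ True] in \<open>simp add: field_simps\<close>)
        qed
        then have "(\<lambda>n. s n x) \<longlonglongrightarrow> g x"
          by (rule Lim_transform_eventually)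
             (use eventually_ge_at_top[of 1] in \<open>eventually_elim, simp add: s_in[OF _ True]\<close>)
        then show ?thesis using True by simp
      qed
    qed
    show "AE x in lborel. norm (s n x) \<le> indicator {0..<1} x * B" for n
    proof (rule AE_I2)
      fix x :: real
      show "norm (s n x) \<le> indicator {0..<1} x * B"
      proof (cases "x \<in> {0..<1} \<and> 1 \<le> n")
        case True
        then have "s n x = g (real (nat \<lfloor>real n * x\<rfloor>) / real n)" "nat \<lfloor>real n * x\<rfloor> < n"
          using s_in[of n x] by auto
        moreover have "real (nat \<lfloor>real n * x\<rfloor>) / real n \<in> {0..<1}"
          using calculation(2) True by (simp add: field_simps)
        ultimately show ?thesis using bound True by simp
      next
        case False
        then have "s n x = 0" using s_out[of x n] by (cases "n = 0") (auto simp: s_def)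
        then show ?thesis using B by simp
      qed
    qed
  qed
  then show ?thesis by (simp add: int_s set_lebesgue_integral_def)
qed

text \<open>Near 1 the linear decay of \<open>w\<close> cancels the pole; elsewhere
  \<open>1 - x\<close> exceeds \<open>x0\<close> and \<open>w\<close> is bounded by compactness. The
  two bounds are simply added.\<close>

lemma h_fun_bounded:
  assumes cont: "continuous_on {0..1} w"
    and lin: "\<exists>x0\<in>{0<..<1}. \<exists>c>0. \<forall>x\<in>{1 - x0..1}. \<bar>w x\<bar> \<le> c * (1 - x)"
  obtains B where "0 < B" "\<And>x. x \<in> {0..<1} \<Longrightarrow> \<bar>h_fun w x\<bar> \<le> B"
proof -
  obtain x0 c where x0: "0 < x0" "x0 < 1" and c: "0 < c"
    and near: "\<And>x. x \<in> {1 - x0..1} \<Longrightarrow> \<bar>w x\<bar> \<le> c * (1 - x)"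
    using lin by auto
  have "bounded (w ` {0..1})"
    by (intro compact_imp_bounded compact_continuous_image cont compact_Icc)
  then have "\<exists>K. \<forall>x\<in>{0..1}. \<bar>w x\<bar> \<le> K"
    by (auto simp: bounded_iff)
  then obtain K where K: "\<And>x. x \<in> {0..1} \<Longrightarrow> \<bar>w x\<bar> \<le> K"
    by blast
  have "0 \<le> K" using K[of 0] by auto
  show ?thesis
  proof (rule that[of "c + K / x0"])
    show "0 < c + K / x0" using c x0 \<open>0 \<le> K\<close> by (simp add: add_pos_nonneg)
    fix x :: real assume x: "x \<in> {0..<1}"
    show "\<bar>h_fun w x\<bar> \<le> c + K / x0"
    proof (cases "1 - x0 \<le> x")
      case True
      then have "\<bar>w x\<bar> \<le> c * (1 - x)" using near x by simp
      then have "\<bar>h_fun w x\<bar> \<le> c" using x by (simp add: h_fun_def abs_divide field_simps)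
      then show ?thesis using x0 \<open>0 \<le> K\<close> by (simp add: add_increasing2)
    next
      case False
      have "\<bar>h_fun w x\<bar> = \<bar>w x\<bar> / (1 - x)" using x by (simp add: h_fun_def abs_divide)
      also have "\<dots> \<le> K / x0" using K[of x] x x0 False by (intro frac_le) auto
      finally show ?thesis using c by simp
    qed
  qed
qed

text \<open>Second order Taylor expansion, with the error measured against the square itself: summed
  over the grid, it is then a small multiple of the quadratic term.\<close>

lemma neg_ln_one_minus_quadratic:
  assumes "0 < e"
  obtains d :: real where "0 < d" "\<And>x. \<bar>x\<bar> < d \<Longrightarrow> \<bar>- ln (1 - x) - x - x\<^sup>2 / 2\<bar> \<le> e * x\<^sup>2"
proof -
  have "((\<lambda>x::real. (- ln (1 - x) - x - x\<^sup>2 / 2) / x\<^sup>2) \<longlongrightarrow> 0) (at 0)"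
    by real_asymp
  then have "\<forall>\<^sub>F x in at (0::real). dist ((- ln (1 - x) - x - x\<^sup>2 / 2) / x\<^sup>2) 0 < e"
    using assms by (rule tendstoD)
  then obtain d where d: "0 < d" and *: "\<And>x::real. x \<noteq> 0 \<Longrightarrow> dist x 0 < d \<Longrightarrow> dist ((- ln (1 - x) - x - x\<^sup>2 / 2) / x\<^sup>2) 0 < e"
    unfolding eventually_at by auto
  show ?thesis
  proof (rule that[of "min d (1/2)"])
    fix x :: real assume x: "\<bar>x\<bar> < min d (1/2)"
    show "\<bar>- ln (1 - x) - x - x\<^sup>2 / 2\<bar> \<le> e * x\<^sup>2"
    proof (cases "x = 0")
      case False
      then have "\<bar>- ln (1 - x) - x - x\<^sup>2 / 2\<bar> / x\<^sup>2 < e"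
        using *[of x] x by (simp add: abs_divide)
      then show ?thesis using False by (simp add: pos_divide_less_eq less_imp_le)
    qed simp
  qed (use d in auto)
qed

lemma sigma_sq_nonneg: "0 \<le> sigma_sq lam w"
  unfolding sigma_sq_def set_lebesgue_integral_def by (intro mult_nonneg_nonneg integral_nonneg) auto

lemma sum_sq_h_fun_tendsto:
  assumes lam: "lam \<noteq> 0" and cont: "continuous_on {0..1} w"
    and bound: "\<And>x. x \<in> {0..<1} \<Longrightarrow> \<bar>h_fun w x\<bar> \<le> B"
  shows "(\<lambda>n. (\<Sum>k<n. (h_fun w (real k / real n))\<^sup>2) / real n) \<longlonglongrightarrow> lam\<^sup>2 * sigma_sq lam w"
proof -
  have "continuous_on {0..<1} (h_fun w)"
    unfolding h_fun_def by (intro continuous_intros continuous_on_subset[OF cont]) auto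
  then have "continuous_on {0..<1} (\<lambda>x. (h_fun w x)\<^sup>2)"
    by (intro continuous_intros)
  moreover have "\<bar>(h_fun w x)\<^sup>2\<bar> \<le> B\<^sup>2" if "x \<in> {0..<1}" for x
    using power_mono[OF bound[OF that], of 2] by simp
  ultimately have "(\<lambda>n. (\<Sum>k<n. (h_fun w (real k / real n))\<^sup>2) / real n)
      \<longlonglongrightarrow> (LINT x:{0..<1}|lborel. (h_fun w x)\<^sup>2)"
    by (rule riemann_sum_tendsto)
  also have "(LINT x:{0..<1}|lborel. (h_fun w x)\<^sup>2) = lam\<^sup>2 * sigma_sq lam w"
    using lam by (simp add: sigma_sq_def h_fun_def power_divide)
  finally show ?thesis .
qed

section \<open>Limit of the scaled cumulants\<close>

lemma (in exponential_sample) C_stat_log_moments: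
  assumes cont: "continuous_on {0..1} w"
    and B: "0 < B" and bound: "\<And>x. x \<in> {0..<1} \<Longrightarrow> \<bar>h_fun w x\<bar> \<le> B"
    and a_pos: "\<And>n. 1 \<le> n \<Longrightarrow> 0 < a n"
    and na: "filterlim (\<lambda>n. real n * a n) at_top sequentially"
  shows "\<exists>L. (\<forall>\<^sub>F n in sequentially.
      has_bochner_integral M (\<lambda>\<omega>. exp (\<theta> / a n * (sqrt (real n * a n) *
        (C_stat w X n \<omega> - expectation (C_stat w X n))))) (exp (L n / a n)))
    \<and> L \<longlonglongrightarrow> sigma_sq lam w * \<theta>\<^sup>2 / 2"
proof -
  \<comment> \<open>The total multiplier of \<open>C_stat\<close> is \<open>real n * u n\<close>, so
    the factors of the generating function are \<open>1 / (1 - x n k)\<close>.\<close>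
  define u where "u n = \<theta> / sqrt (real n * a n)" for n
  define x where "x n k = u n * h_fun w (real k / real n) / lam" for n k
  \<comment> \<open>Subtracting \<open>x n k\<close> is the effect of the centring; \<open>Q\<close>
    below is the quadratic part that remains.\<close>
  define L where "L n = a n * (\<Sum>k<n. - ln (1 - x n k) - x n k)" for n
  define Q where "Q n = a n * (\<Sum>k<n. (x n k)\<^sup>2 / 2)" for n
  define q where "q = sigma_sq lam w * \<theta>\<^sup>2 / 2"
  have q: "0 \<le> q" by (simp add: q_def sigma_sq_nonneg)
  have "filterlim (\<lambda>n. sqrt (real n * a n)) at_infinity sequentially"
    by (intro filterlim_at_top_imp_at_infinity filterlim_compose[OF sqrt_at_top na])
  then have "u \<longlonglongrightarrow> 0"
    unfolding u_def by (intro tendsto_divide_0[OF tendsto_const])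
  then have u_small: "\<forall>\<^sub>F n in sequentially. \<bar>u n\<bar> < r" if "0 < r" for r
    using tendstoD[OF _ that, of u 0] by simp
  have x_bound: "\<bar>x n k\<bar> \<le> \<bar>u n\<bar> * B / lam" if "k < n" for n k
  proof -
    have "\<bar>h_fun w (real k / real n)\<bar> \<le> B" using that by (intro bound) auto
    then show ?thesis
      using lam_pos by (simp add: x_def abs_mult abs_divide divide_right_mono mult_left_mono)
  qed
  have x_small: "\<forall>\<^sub>F n in sequentially. \<forall>k<n. \<bar>x n k\<bar> < r" if r: "0 < r" for r
  proof -
    have "\<forall>\<^sub>F n in sequentially. \<bar>u n\<bar> < r * lam / B"
      using r lam_pos B by (intro u_small) simp
    then show ?thesis
    proof eventually_elim
      case (elim n)
      then have "\<bar>u n\<bar> * B / lam < r" using B lam_pos by (simp add: field_simps)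
      then show ?case using x_bound le_less_trans by blast
    qed
  qed
  \<comment> \<open>The speed and the scaling combine to the weight \<open>1 / n\<close> of a
    Riemann sum.\<close>
  have au: "a n * (u n)\<^sup>2 = \<theta>\<^sup>2 / real n" if "1 \<le> n" for n
    using a_pos[OF that] that by (simp add: u_def power_divide)
  have "\<forall>\<^sub>F n in sequentially. \<theta>\<^sup>2 / (2 * lam\<^sup>2) * ((\<Sum>k<n. (h_fun w (real k / real n))\<^sup>2) / real n) = Q n"
    using eventually_ge_at_top[of 1]
  proof eventually_elim
    case (elim n)
    have "Q n = a n * (u n)\<^sup>2 / (2 * lam\<^sup>2) * (\<Sum>k<n. (h_fun w (real k / real n))\<^sup>2)"
      unfolding Q_def x_def sum_distrib_left by (intro sum.cong) (simp_all add: power_mult_distrib power_divide)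
    then show ?case by (simp add: au[OF elim])
  qed
  moreover have "(\<lambda>n. \<theta>\<^sup>2 / (2 * lam\<^sup>2) * ((\<Sum>k<n. (h_fun w (real k / real n))\<^sup>2) / real n)) \<longlonglongrightarrow>
      \<theta>\<^sup>2 / (2 * lam\<^sup>2) * (lam\<^sup>2 * sigma_sq lam w)"
    using lam_pos by (intro tendsto_mult[OF tendsto_const] sum_sq_h_fun_tendsto[OF _ cont bound]) auto
  ultimately have "Q \<longlonglongrightarrow> \<theta>\<^sup>2 / (2 * lam\<^sup>2) * (lam\<^sup>2 * sigma_sq lam w)"
    by (rule Lim_transform_eventually[rotated])
  then have Q: "Q \<longlonglongrightarrow> q"
    using lam_pos by (simp add: q_def mult.commute)
  have "(\<lambda>n. L n - Q n) \<longlonglongrightarrow> 0"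
  proof (rule tendstoI)
    fix e :: real assume e: "0 < e"
    \<comment> \<open>The accumulated error is at most \<open>2 * e' * Q n\<close>, and eventually
      \<open>Q n < q + 1\<close>.\<close>
    define e' where "e' = e / (2 * (q + 1))"
    have e': "0 < e'" using e q by (simp add: e'_def)
    obtain d :: real where d: "0 < d"
      and quad: "\<And>x. \<bar>x\<bar> < d \<Longrightarrow> \<bar>- ln (1 - x) - x - x\<^sup>2 / 2\<bar> \<le> e' * x\<^sup>2"
      using neg_ln_one_minus_quadratic[OF e'] by blast
    have "\<forall>\<^sub>F n in sequentially. Q n < q + 1"
      by (rule order_tendstoD(2)[OF Q]) simp
    then show "\<forall>\<^sub>F n in sequentially. dist (L n - Q n) 0 < e"
      using x_small[OF d] eventually_ge_at_top[of 1]
    proof eventually_elim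
      case (elim n)
      have a: "0 < a n" using elim a_pos by simp
      have "L n - Q n = a n * (\<Sum>k<n. - ln (1 - x n k) - x n k - (x n k)\<^sup>2 / 2)"
        by (simp add: L_def Q_def right_diff_distrib[symmetric] sum_subtractf)
      then have "\<bar>L n - Q n\<bar> = a n * \<bar>\<Sum>k<n. - ln (1 - x n k) - x n k - (x n k)\<^sup>2 / 2\<bar>"
        using a by (simp add: abs_mult)
      also have "\<dots> \<le> a n * (\<Sum>k<n. \<bar>- ln (1 - x n k) - x n k - (x n k)\<^sup>2 / 2\<bar>)"
        using a by (intro mult_left_mono sum_abs) auto
      also have "\<dots> \<le> a n * (\<Sum>k<n. e' * (x n k)\<^sup>2)"
        using a elim by (intro mult_left_mono sum_mono quad) auto
      also have "\<dots> = 2 * e' * Q n"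
        by (simp add: Q_def sum_distrib_left mult_ac sum_divide_distrib[symmetric])
      also have "\<dots> < 2 * e' * (q + 1)"
        using elim e' by (intro mult_strict_left_mono) auto
      also have "\<dots> = e" using q by (simp add: e'_def field_simps)
      finally show ?case by simp
    qed
  qed
  from tendsto_add[OF this Q] have "L \<longlonglongrightarrow> q" by simp
  moreover have "\<forall>\<^sub>F n in sequentially.
      has_bochner_integral M (\<lambda>\<omega>. exp (\<theta> / a n * (sqrt (real n * a n) *
        (C_stat w X n \<omega> - expectation (C_stat w X n))))) (exp (L n / a n))"
    using x_small[OF zero_less_one] eventually_ge_at_top[of 1]
  proof eventually_elim
    case (elim n)
    have a: "0 < a n" and n: "0 < real n" using elim a_pos by auto
    define t where "t = real n * u n"
    define m where "m = expectation (C_stat w X n)"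
    have t_eq: "\<theta> / a n * sqrt (real n * a n) = t"
    proof -
      have "sqrt (real n * a n) * sqrt (real n * a n) = real n * a n" using a n by simp
      then show ?thesis using a n by (simp add: t_def u_def field_simps)
    qed
    have x_eq: "t * h_fun w (real k / real n) / (real n * lam) = x n k" for k
      using n by (simp add: t_def x_def)
    \<comment> \<open>The exact mean equals the sum of the linear terms, which is why they drop out
      completely.\<close>
    have tm: "t * m = (\<Sum>k<n. x n k)"
      unfolding m_def expectation_C_stat[OF elim(2)] sum_distrib_left x_eq[symmetric] by simp
    have "t * h_fun w (real k / real n) < real n * lam" if "k < n" for k
    proof -
      have "x n k < 1" using elim(1) that by (auto dest: spec[of _ k])
      then show ?thesis using n lam_pos by (simp add: x_eq[symmetric] field_simps)
    qed
    then have "has_bochner_integral M (\<lambda>\<omega>. exp (t * C_stat w X n \<omega>))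
        (exp (\<Sum>k<n. - ln (1 - x n k)))"
      using C_stat_mgf[OF elim(2), of t w] by (simp only: x_eq)
    then have "has_bochner_integral M (\<lambda>\<omega>. exp (- (t * m)) * exp (t * C_stat w X n \<omega>))
        (exp (- (t * m)) * exp (\<Sum>k<n. - ln (1 - x n k)))"
      by (rule has_bochner_integral_mult_right)
    moreover have "exp (- (t * m)) * exp (t * c) = exp (\<theta> / a n * (sqrt (real n * a n) * (c - m)))" for c
    proof -
      have "\<theta> / a n * (sqrt (real n * a n) * (c - m)) = t * (c - m)"
        by (simp only: t_eq mult.assoc[symmetric])
      then show ?thesis by (simp add: mult_exp_exp right_diff_distrib)
    qed
    moreover have "exp (- (t * m)) * exp (\<Sum>k<n. - ln (1 - x n k)) = exp (L n / a n)"
      using a by (simp add: mult_exp_exp tm L_def sum_subtractf)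
    ultimately show ?case by (simp only: m_def)
  qed
  ultimately show ?thesis unfolding q_def by blast
qed

theorem proposition3p3:
  fixes M :: "'a measure" and X :: "nat \<Rightarrow> 'a \<Rightarrow> real"
    and lam :: real and w :: "real \<Rightarrow> real" and a :: "nat \<Rightarrow> real"
  assumes "prob_space M"
    and "lam > 0"
    and "prob_space.indep_vars M (\<lambda>_. borel) X {1..}"
    and "\<And>n. n \<ge> 1 \<Longrightarrow> distributed M lborel (X n) (\<lambda>t. ennreal (exponential_density lam t))"
    and "continuous_on {0..1} w"
    and "\<exists>x0\<in>{0<..<1}. \<exists>c>0. \<forall>x\<in>{1 - x0..1}. \<bar>w x\<bar> \<le> c * (1 - x)"
    and "\<exists>\<delta>>0. \<forall>\<theta>. \<bar>\<theta>\<bar> < \<delta> \<longrightarrow> \<bar>Lambda_fun lam w \<theta>\<bar> \<noteq> \<infinity>"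
    and "\<And>n. n \<ge> 1 \<Longrightarrow> a n > 0"
    and "a \<longlonglongrightarrow> 0"
    and "filterlim (\<lambda>n. real n * a n) at_top sequentially"
  shows "satisfies_LDP M
           (\<lambda>n \<omega>. sqrt (real n * a n) *
              (C_stat w X n \<omega> - prob_space.expectation M (C_stat w X n)))
           (\<lambda>n. 1 / a n) (MD_rate lam w)
         \<and> good_rate (MD_rate lam w)"
proof
  interpret exponential_sample M X lam
    using assms(1-4) by (auto simp: exponential_sample_def exponential_sample_axioms_def)
  obtain B where B: "0 < B" "\<And>x. x \<in> {0..<1} \<Longrightarrow> \<bar>h_fun w x\<bar> \<le> B"
    using h_fun_bounded[OF assms(5,6)] by blast
  interpret gaussian_moments M "\<lambda>n \<omega>. sqrt (real n * a n) * (C_stat w X n \<omega> - expectation (C_stat w X n))"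
    a "sigma_sq lam w"
  proof
    show "(\<lambda>\<omega>. sqrt (real n * a n) * (C_stat w X n \<omega> - expectation (C_stat w X n))) \<in> borel_measurable M" for n
      using C_stat_measurable[of w n] by measurable
  qed (use assms(8,9) C_stat_log_moments[OF assms(5) B assms(8,10)] sigma_sq_nonneg
      in \<open>auto simp: has_bochner_integral_iff\<close>)
  show "satisfies_LDP M (\<lambda>n \<omega>. sqrt (real n * a n) * (C_stat w X n \<omega> - expectation (C_stat w X n)))
      (\<lambda>n. 1 / a n) (MD_rate lam w)"
    unfolding MD_rate_eq by (rule satisfies_LDP_gauss)
  show "good_rate (MD_rate lam w)"
    unfolding MD_rate_eq by (intro good_rate_gauss sigma_sq_nonneg)
qed

end
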